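(* Let $(R,\mathfrak m)$ be a one-dimensional, analytically unramified, Cohen-Macaulay (Noetherian) local ring with infinite residue field and embedding dimension $\nu$. Let $\overline R$ be the integral closure of $R$ in its total ring of fractions and let $\mathfrak c=R:\overline R$ be the conductor. Suppose that $R$ has a canonical reduction $x\omega$, where $(x)$ is a minimal reduction of $\mathfrak m$ and $\omega$ is a canonical ideal with $R\subseteq\omega\subseteq\overline R$ and $x\omega\subseteq\mathfrak m$, and suppose that there exist a minimal generating set $\{x,x_2,\dots,x_\nu\}$ of $\mathfrak m$ and an index $i\in\{2,\dots,\nu\}$ such that $x_i\in\mathfrak m:\omega$. Then $$e(\mathfrak c)\le \nu\cdot\ell(R/\mathfrak c).$$
   Context: Analytically unramified means that the $\mathfrak m$-adic completion $\hat R$ is reduced; in the present setting this is equivalent to $\overline R$ being a finite $R$-module. $Q(R)$ denotes the total ring of fractions of $R$. For $R$-submodules $I,J$ of $Q(R)$, $I:J=\{z\in Q(R) : zJ\subseteq I\}$; thus $\mathfrak c=R:\overline R$ is the conductor and $\mathfrak m:\omega=\{z\in Q(R): z\omega\subseteq\mathfrak m\}$. $\ell$ denotes length as an $R$-module, $e(\mathfrak c)$ is the Hilbert-Samuel multiplicity of the $\mathfrak m$-primary ideal $\mathfrak c$ (on $R$), and $\nu=\dim_{R/\mathfrak m}\mathfrak m/\mathfrak m^2$ is the embedding dimension. All fractional ideals are assumed to contain a non-zero divisor of $Q(R)$. A canonical ideal of $R$ is a fractional ideal $\omega$ such that $J=\omega:(\omega:J)$ for every fractional ideal $J$ of $R$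 (equivalently, a fractional ideal isomorphic to a canonical module of $R$). When $(R,\mathfrak m)$ is a one-dimensional, analytically unramified, Cohen-Macaulay (Noetherian) local ring with infinite residue field, canonical ideals exist, any two of them differ by multiplication by a non-zero divisor of $Q(R)$, and one can always choose a canonical ideal $\omega$ with $R\subseteq\omega\subseteq\overline R$. The ring $R$ has a canonical reduction if there exists a canonical ideal of $R$ that is a reduction of $\mathfrak m$; for $\omega$ with $R\subseteq\omega\subseteq\overline R$ this is equivalent to the existence of a minimal reduction $(x)$ of $\mathfrak m$ with $x\omega\subseteq\mathfrak m$, in which case $x\omega$ is the canonical reduction. A minimal reduction of $\mathfrak m$ is a reduction minimal with respect to inclusion; here it is a principal ideal generated by a non-zero divisor which is part of a minimal generating set of $\mathfrak m$. *)

theory Defs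
  imports
    "HOL-Algebra.Algebra"
    "HOL-Library.Extended_Real"
    "Jordan_Normal_Form.Missing_VectorSpace"
begin

section \<open>Local rings\<close>

definition local_ring :: "('a, 'b) ring_scheme \<Rightarrow> 'a set \<Rightarrow> bool" where
  "local_ring R m \<longleftrightarrow> cring R \<and> maximalideal m R \<and> (\<forall>n. maximalideal n R \<longrightarrow> n = m)"

definition krull_dim :: "('a, 'b) ring_scheme \<Rightarrow> enat" where
  "krull_dim R = Sup {enat n | n P. (\<forall>i\<le>n. primeideal (P i) R) \<and> (\<forall>i<n. P i \<subset> P (Suc i))}"

definition regular_sequence :: "('a, 'b) ring_scheme \<Rightarrow> 'a list \<Rightarrow> bool" where
  "regular_sequence R xs \<longleftrightarrow>
     set xs \<subseteq> carrier R \<and> Idl\<^bsub>R\<^esub> (set xs) \<noteq> carrier R \<and>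
     (\<forall>i<length xs. \<forall>a\<in>carrier R.
        xs ! i \<otimes>\<^bsub>R\<^esub> a \<in> Idl\<^bsub>R\<^esub> (set (take i xs)) \<longrightarrow> a \<in> Idl\<^bsub>R\<^esub> (set (take i xs)))"

definition depth :: "('a, 'b) ring_scheme \<Rightarrow> 'a set \<Rightarrow> enat" where
  "depth R m = Sup {enat (length xs) | xs. regular_sequence R xs \<and> set xs \<subseteq> m}"

definition cohen_macaulay_local :: "('a, 'b) ring_scheme \<Rightarrow> 'a set \<Rightarrow> bool" where
  "cohen_macaulay_local R m \<longleftrightarrow>
     noetherian_ring R \<and> local_ring R m \<and> depth R m = krull_dim R"

text \<open>Powers of ideals are powers in the library's monoid of ideals, with unit the whole ring.\<close>

abbreviation ideal_power :: "('a, 'b) ring_scheme \<Rightarrow> 'a set \<Rightarrow> nat \<Rightarrow> 'a set" where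
  "ideal_power R I n \<equiv> I [^]\<^bsub>ideals_set R\<^esub> n"

text \<open>
  The inverse limit of the rings \<open>R / I\<^sup>n\<close>: an element is a sequence of cosets, and
  compatibility with the transition maps is inclusion of consecutive cosets.
\<close>

definition adic_completion :: "('a, 'b) ring_scheme \<Rightarrow> 'a set \<Rightarrow> (nat \<Rightarrow> 'a set) ring" where
  "adic_completion R I =
     \<lparr>carrier = {f. \<forall>n. f n \<in> carrier (R Quot ideal_power R I n) \<and> f (Suc n) \<subseteq> f n},
      monoid.mult = (\<lambda>f g n. f n \<otimes>\<^bsub>R Quot ideal_power R I n\<^esub> g n),
      one = (\<lambda>n. \<one>\<^bsub>R Quot ideal_power R I n\<^esub>),
      ring.zero = (\<lambda>n. \<zero>\<^bsub>R Quot ideal_power R I n\<^esub>),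
      add = (\<lambda>f g n. f n \<oplus>\<^bsub>R Quot ideal_power R I n\<^esub> g n)\<rparr>"

definition reduced_ring :: "('a, 'b) ring_scheme \<Rightarrow> bool" where
  "reduced_ring R \<longleftrightarrow> (\<forall>a\<in>carrier R. \<forall>n::nat. a [^]\<^bsub>R\<^esub> n = \<zero>\<^bsub>R\<^esub> \<longrightarrow> a = \<zero>\<^bsub>R\<^esub>)"

definition analytically_unramified :: "('a, 'b) ring_scheme \<Rightarrow> 'a set \<Rightarrow> bool" where
  "analytically_unramified R m \<longleftrightarrow> reduced_ring (adic_completion R m)"


section \<open>Length, multiplicity and embedding dimension\<close>

text \<open>The ring \<open>B\<close> as a module over the domain of the ring homomorphism \<open>\<phi>\<close> into \<open>B\<close>.\<close>

definition ring_module :: "('b, 'c) ring_scheme \<Rightarrow> ('a \<Rightarrow> 'b) \<Rightarrow> ('a, 'b) module" where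
  "ring_module B \<phi> =
     \<lparr>carrier = carrier B, monoid.mult = monoid.mult B, one = \<one>\<^bsub>B\<^esub>, ring.zero = \<zero>\<^bsub>B\<^esub>,
      add = add B,
      smult = (\<lambda>a b. \<phi> a \<otimes>\<^bsub>B\<^esub> b)\<rparr>"

definition quotient_module :: "('a, 'b) ring_scheme \<Rightarrow> 'a set \<Rightarrow> ('a, 'a set) module" where
  "quotient_module R I = ring_module (R Quot I) (\<lambda>a. I +>\<^bsub>R\<^esub> a)"

definition module_length :: "('a, 'b) ring_scheme \<Rightarrow> ('a, 'c, 'd) module_scheme \<Rightarrow> enat" where
  "module_length R M =
     Sup {enat n | n N. (\<forall>i\<le>n. LinearCombinations.submodule R (N i) M) \<and> (\<forall>i<n. N i \<subset> N (Suc i))}"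

definition hilbert_samuel_multiplicity :: "('a, 'b) ring_scheme \<Rightarrow> 'a set \<Rightarrow> ereal" where
  "hilbert_samuel_multiplicity R I =
     (let d = the_enat (krull_dim R) in
      lim (\<lambda>n. ereal (fact d / real n ^ d) *
               ereal_of_enat (module_length R (quotient_module R (ideal_power R I n)))))"

text \<open>
  The module \<open>m / m\<^sup>2\<close> over \<open>R / m\<close>. Scalar multiplication takes a coset of \<open>m\<close> and a coset of
  \<open>m\<^sup>2\<close> in \<open>m\<close> to the coset of \<open>m\<^sup>2\<close> of the products of their elements. The fields \<open>mult\<close> and
  \<open>one\<close> are only required by the record type.
\<close>

definition cotangent_module :: "('a, 'b) ring_scheme \<Rightarrow> 'a set \<Rightarrow> ('a set, 'a set) module" where
  "cotangent_module R m =
     (let m2 = ideal_power R m 2 in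
      \<lparr>carrier = (\<lambda>a. m2 +>\<^bsub>R\<^esub> a) ` m,
       monoid.mult = monoid.mult (R Quot m2), one = \<one>\<^bsub>R Quot m2\<^esub>,
       ring.zero = \<zero>\<^bsub>R Quot m2\<^esub>, add = add (R Quot m2), smult = rcoset_mult R m2\<rparr>)"

definition embedding_dim :: "('a, 'b) ring_scheme \<Rightarrow> 'a set \<Rightarrow> nat" where
  "embedding_dim R m = vectorspace.dim (R Quot m) (cotangent_module R m)"

definition minimal_generating_set :: "('a, 'b) ring_scheme \<Rightarrow> 'a set \<Rightarrow> 'a set \<Rightarrow> bool" where
  "minimal_generating_set R I S \<longleftrightarrow>
     S \<subseteq> carrier R \<and> Idl\<^bsub>R\<^esub> S = I \<and> (\<forall>T. T \<subset> S \<longrightarrow> Idl\<^bsub>R\<^esub> T \<noteq> I)"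


section \<open>Reductions\<close>

definition reduction :: "('a, 'b) ring_scheme \<Rightarrow> 'a set \<Rightarrow> 'a set \<Rightarrow> bool" where
  "reduction R J I \<longleftrightarrow> ideal I R \<and> ideal J R \<and> I \<subseteq> J \<and>
     (\<exists>n. I \<cdot>\<^bsub>R\<^esub> ideal_power R J n = ideal_power R J (Suc n))"

definition minimal_reduction :: "('a, 'b) ring_scheme \<Rightarrow> 'a set \<Rightarrow> 'a set \<Rightarrow> bool" where
  "minimal_reduction R J I \<longleftrightarrow>
     reduction R J I \<and> (\<forall>I'. reduction R J I' \<and> I' \<subseteq> I \<longrightarrow> I' = I)"


section \<open>The total ring of fractions\<close>

definition nonzero_divisors :: "('a, 'b) ring_scheme \<Rightarrow> 'a set" where
  "nonzero_divisors R = {a \<in> carrier R. \<forall>b\<in>carrier R. a \<otimes>\<^bsub>R\<^esub> b = \<zero>\<^bsub>R\<^esub> \<longrightarrow> b = \<zero>\<^bsub>R\<^esub>}"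

text \<open>
  \<open>R\<close> is identified with its image in its total ring of fractions \<open>Q\<close>, which is thereby
  determined up to unique isomorphism over \<open>R\<close>.
\<close>

definition total_ring_of_fractions ::
    "('a, 'b) ring_scheme \<Rightarrow> ('a, 'b) ring_scheme \<Rightarrow> bool" where
  "total_ring_of_fractions R Q \<longleftrightarrow>
     cring Q \<and> subcring (carrier R) Q \<and> R = Q\<lparr>carrier := carrier R\<rparr> \<and>
     nonzero_divisors R \<subseteq> Units Q \<and>
     (\<forall>z\<in>carrier Q. \<exists>a\<in>carrier R. \<exists>s\<in>nonzero_divisors R. z = a \<otimes>\<^bsub>Q\<^esub> inv\<^bsub>Q\<^esub> s)"

definition integral_closure :: "('a, 'b) ring_scheme \<Rightarrow> ('a, 'b) ring_scheme \<Rightarrow> 'a set" where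
  "integral_closure R Q =
     {z \<in> carrier Q. \<exists>p \<in> carrier ((carrier R) [X]\<^bsub>Q\<^esub>).
        p \<noteq> [] \<and> hd p = \<one>\<^bsub>Q\<^esub> \<and> ring.eval Q p z = \<zero>\<^bsub>Q\<^esub>}"

definition colon :: "('a, 'b) ring_scheme \<Rightarrow> 'a set \<Rightarrow> 'a set \<Rightarrow> 'a set" where
  "colon Q I J = {z \<in> carrier Q. \<forall>y\<in>J. z \<otimes>\<^bsub>Q\<^esub> y \<in> I}"

definition conductor :: "('a, 'b) ring_scheme \<Rightarrow> ('a, 'b) ring_scheme \<Rightarrow> 'a set" where
  "conductor R Q = colon Q (carrier R) (integral_closure R Q)"

definition fractional_ideal ::
    "('a, 'b) ring_scheme \<Rightarrow> ('a, 'b) ring_scheme \<Rightarrow> 'a set \<Rightarrow> bool" where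
  "fractional_ideal R Q I \<longleftrightarrow>
     LinearCombinations.submodule R I (ring_module Q (\<lambda>a. a)) \<and>
     (\<exists>d\<in>nonzero_divisors R. \<forall>z\<in>I. d \<otimes>\<^bsub>Q\<^esub> z \<in> carrier R) \<and>
     I \<inter> nonzero_divisors Q \<noteq> {}"

definition canonical_ideal ::
    "('a, 'b) ring_scheme \<Rightarrow> ('a, 'b) ring_scheme \<Rightarrow> 'a set \<Rightarrow> bool" where
  "canonical_ideal R Q \<omega> \<longleftrightarrow> fractional_ideal R Q \<omega> \<and>
     (\<forall>J. fractional_ideal R Q J \<longrightarrow> colon Q \<omega> (colon Q \<omega> J) = J)"

definition canonical_reduction ::
    "('a, 'b) ring_scheme \<Rightarrow> ('a, 'b) ring_scheme \<Rightarrow> 'a set \<Rightarrow> 'a set \<Rightarrow> bool" where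
  "canonical_reduction R Q m K \<longleftrightarrow> canonical_ideal R Q K \<and> reduction R m K"

end

theory Submission
  imports Defs
begin

text \<open>
  Write \<open>V\<close> for the integral closure and \<open>\<cc>\<close> for the conductor. If \<open>R / \<cc>\<close> has infinite length there
  is nothing to prove; otherwise \<open>\<cc>\<close> contains a power of \<open>x\<close> and \<open>V / R\<close> has finite length.

  The infinite residue field makes \<open>\<cc>\<close> principal over \<open>V\<close>: if \<open>yV\<close> is maximal among the
  principal \<open>V\<close>-ideals in \<open>\<cc>\<close> and \<open>w \<in> \<cc>\<close>, then \<open>u = w / y\<close> satisfies a polynomial relation
  with a unit coefficient; for \<open>b\<close> not a root of it modulo \<open>m\<close>, \<open>1 / (u - b)\<close> is integral, so
  \<open>yV + wV\<close> is generated by \<open>w - b y\<close>. Hence \<open>e(\<cc>) = \<ell>(V / \<cc>) = \<ell>(R / \<cc>) + \<ell>(V / R)\<close>.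

  Duality with respect to \<open>\<omega>\<close> turns \<open>\<ell>(V / R)\<close> into \<open>\<ell>(\<omega> / \<cc>) = \<ell>(\<omega> / R) + \<ell>(R / \<cc>)\<close>. With
  \<open>z = x\<^sub>i / x\<close> and \<open>I = R + zR\<close>, duality also gives \<open>\<ell>(\<omega> / R) \<le> \<ell>(I\<omega> / I)\<close>. Since
  \<open>xI\<omega> \<subseteq> m\<close>, the latter is at most \<open>\<ell>(m / xI)\<close>, and \<open>m / xI\<close> is generated by the remaining \<open>\<nu> - 2\<close>
  generators of \<open>m\<close>, each annihilated by \<open>\<cc>\<close>.
\<close>

section \<open>Chains of sets\<close>

text \<open>Length counts strict inclusions, not members, so a one-element family has height 0; the
  supremum over no chains gives the empty family height 0 as well. The length of a module is the
  height of its family of submodules.\<close>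

definition height :: "'a set set \<Rightarrow> enat" where
  "height S = Sup {enat n | n N. (\<forall>i\<le>n. N i \<in> S) \<and> (\<forall>i<n. N i \<subset> N (Suc i))}"

lemma height_ge:
  assumes "\<And>i. i \<le> n \<Longrightarrow> N i \<in> S" "\<And>i. i < n \<Longrightarrow> N i \<subset> N (Suc i)"
  shows "enat n \<le> height S"
  unfolding height_def using assms by (intro Sup_upper) blast

lemma height_leI:
  assumes "\<And>n N. \<lbrakk>\<And>i. i \<le> n \<Longrightarrow> N i \<in> S; \<And>i. i < n \<Longrightarrow> N i \<subset> N (Suc i)\<rbrakk> \<Longrightarrow> enat n \<le> h"
  shows "height S \<le> h"
  unfolding height_def using assms by (intro Sup_least) blast

text \<open>An infinite supremum is not attained, so for \<open>n = Suc k\<close> a chain of some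
  length above \<open>k\<close> is chosen and cut off after \<open>n\<close> inclusions.
  Nonemptiness of \<open>S\<close> provides the one-term chain for \<open>n = 0\<close>.\<close>

lemma height_geE:
  assumes "enat n \<le> height S" "S \<noteq> {}"
  obtains N where "\<And>i. i \<le> n \<Longrightarrow> N i \<in> S" "\<And>i. i < n \<Longrightarrow> N i \<subset> N (Suc i)"
proof (cases n)
  case 0
  then show ?thesis using that[of "\<lambda>_. SOME x. x \<in> S"] assms(2) some_in_eq by auto
next
  case (Suc k)
  then have "enat k < height S" using assms(1) by (metis Suc_ile_eq)
  then obtain l N where l: "enat k < enat l" "\<forall>i\<le>l. N i \<in> S" "\<forall>i<l. N i \<subset> N (Suc i)"
    unfolding height_def less_Sup_iff by blast
  with Suc show ?thesis by (intro that[of N]) auto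
qed

lemma height_mono_map:
  assumes "\<And>A. A \<in> S \<Longrightarrow> f A \<in> T" "\<And>A B. \<lbrakk>A \<in> S; B \<in> S; A \<subset> B\<rbrakk> \<Longrightarrow> f A \<subset> f B"
  shows "height S \<le> height T"
proof (rule height_leI)
  fix n and N :: "nat \<Rightarrow> 'a set"
  assume "\<And>i. i \<le> n \<Longrightarrow> N i \<in> S" "\<And>i. i < n \<Longrightarrow> N i \<subset> N (Suc i)"
  then show "enat n \<le> height T"
    using assms by (intro height_ge[where N = "\<lambda>i. f (N i)"]) auto
qed

lemma height_antimono_map:
  assumes "\<And>A. A \<in> S \<Longrightarrow> f A \<in> T" "\<And>A B. \<lbrakk>A \<in> S; B \<in> S; A \<subset> B\<rbrakk> \<Longrightarrow> f B \<subset> f A"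
  shows "height S \<le> height T"
proof (rule height_leI)
  fix n and N :: "nat \<Rightarrow> 'a set"
  assume N: "\<And>i. i \<le> n \<Longrightarrow> N i \<in> S" "\<And>i. i < n \<Longrightarrow> N i \<subset> N (Suc i)"
  \<comment> \<open>The images decrease, so the chain is read backwards.\<close>
  have "f (N (n - i)) \<subset> f (N (n - Suc i))" if "i < n" for i
  proof -
    have "n - i = Suc (n - Suc i)" using that by simp
    then have "N (n - Suc i) \<subset> N (n - i)" using N(2)[of "n - Suc i"] that by simp
    then show ?thesis using assms(2) N(1) by simp
  qed
  then show "enat n \<le> height T"
    using assms(1) N(1) by (intro height_ge[where N = "\<lambda>i. f (N (n - i))"]) auto
qed

lemma enat_le_via_nat:
  fixes a b :: enat
  assumes "\<And>n. enat n \<le> a \<Longrightarrow> enat n \<le> b"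
  shows "a \<le> b"
proof (cases a)
  case infinity
  then have "enat (Suc n) \<le> b" for n using assms by simp
  then show ?thesis by (cases b) (auto simp: not_less_eq_eq[symmetric])
qed (use assms in auto)

text \<open>Joining chains yields bounds for finite \<open>n\<close> and \<open>k\<close>. If one
  summand is infinite, the instances with 0 for the other already make \<open>c\<close>
  infinite.\<close>

lemma enat_add_le_via_nat:
  fixes a b c :: enat
  assumes "\<And>n k. \<lbrakk>enat n \<le> a; enat k \<le> b\<rbrakk> \<Longrightarrow> enat (n + k) \<le> c"
  shows "a + b \<le> c"
proof (rule enat_le_via_nat)
  fix n assume n: "enat n \<le> a + b"
  show "enat n \<le> c"
  proof (cases a)
    case (enat a')
    show ?thesis
    proof (cases b)
      case b: (enat b')
      then show ?thesis using enat n assms[of a' b'] by (metis enat_ord_simps(1) order_refl order_trans plus_enat_simps(1))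
    next
      case infinity
      then show ?thesis using assms[of 0 n] by (simp add: zero_enat_def[symmetric])
    qed
  next
    case infinity
    then show ?thesis using assms[of n 0] by (simp add: zero_enat_def[symmetric])
  qed
qed

lemma not_infinity_if_le: "a \<le> b \<Longrightarrow> b \<noteq> \<infinity> \<Longrightarrow> a \<noteq> (\<infinity>::enat)"
  by (cases a) simp_all

text \<open>Since \<open>d + a \<le> d + e = a + b\<close>, the finite \<open>a\<close> cancels. It
  serves to compare two ways of computing one length.\<close>

lemma enat_exchange:
  fixes a b d e :: enat
  assumes "a + b = d + e" "a \<le> e" "a \<noteq> \<infinity>"
  shows "d \<le> b"
  using assms by (cases a; cases b; cases d; cases e) auto

section \<open>Submodules of an overring and their lengths\<close>

text \<open>\<open>R\<close> and \<open>Q\<close> share their operation fields, so ideals of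
  \<open>R\<close> and \<open>R\<close>-submodules of \<open>Q\<close> are subsets of one carrier.
  Nontriviality makes a coefficient list headed by \<open>\<one>\<close> a polynomial.\<close>

locale overring = cring Q for Q (structure) +
  fixes R
  assumes R_eq: "R = Q\<lparr>carrier := carrier R\<rparr>"
    and subcring: "subcring (carrier R) Q"
    and nontrivial: "\<one> \<noteq> \<zero>"
begin

lemma R_simps [simp]:
  "monoid.mult R = monoid.mult Q" "add R = add Q" "\<one>\<^bsub>R\<^esub> = \<one>" "\<zero>\<^bsub>R\<^esub> = \<zero>"
  by (subst R_eq, simp)+

lemma R_sub: "r \<in> carrier R \<Longrightarrow> r \<in> carrier Q"
  and R_zero [simp]: "\<zero> \<in> carrier R"
  and R_one [simp]: "\<one> \<in> carrier R"
  and R_neg: "r \<in> carrier R \<Longrightarrow> \<ominus> r \<in> carrier R"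
  and R_mult: "r \<in> carrier R \<Longrightarrow> s \<in> carrier R \<Longrightarrow> r \<otimes> s \<in> carrier R"
  and R_add: "r \<in> carrier R \<Longrightarrow> s \<in> carrier R \<Longrightarrow> r \<oplus> s \<in> carrier R"
  using subcringE[OF subcring] by auto

lemma R_pow: "r \<in> carrier R \<Longrightarrow> r [^] (n::nat) \<in> carrier R"
  by (induction n) (auto intro: R_mult)

lemma R_minus: "r \<in> carrier R \<Longrightarrow> s \<in> carrier R \<Longrightarrow> r \<ominus> s \<in> carrier R"
  by (simp add: minus_eq R_neg R_add)

lemma cring_R: "cring R"
  using subcring_iff[OF subcringE(1)[OF subcring]] subcring R_eq by metis

text \<open>The \<open>R\<close>-submodules of \<open>Q\<close>; negatives come from multiplication
  by -1. The ideals of \<open>R\<close> are those contained in \<open>carrier R\<close>.\<close>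

definition rsub :: "'a set \<Rightarrow> bool" where
  "rsub N \<longleftrightarrow> N \<subseteq> carrier Q \<and> \<zero> \<in> N \<and> (\<forall>a\<in>N. \<forall>b\<in>N. a \<oplus> b \<in> N) \<and>
     (\<forall>r\<in>carrier R. \<forall>a\<in>N. r \<otimes> a \<in> N)"

lemma rsubI:
  assumes "N \<subseteq> carrier Q" "\<zero> \<in> N" "\<And>a b. a \<in> N \<Longrightarrow> b \<in> N \<Longrightarrow> a \<oplus> b \<in> N"
    "\<And>r a. r \<in> carrier R \<Longrightarrow> a \<in> N \<Longrightarrow> r \<otimes> a \<in> N"
  shows "rsub N"
  using assms unfolding rsub_def by blast

lemma rsubD:
  assumes "rsub N"
  shows "a \<in> N \<Longrightarrow> a \<in> carrier Q" "\<zero> \<in> N" "a \<in> N \<Longrightarrow> b \<in> N \<Longrightarrow> a \<oplus> b \<in> N"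
    "r \<in> carrier R \<Longrightarrow> a \<in> N \<Longrightarrow> r \<otimes> a \<in> N"
  using assms unfolding rsub_def by blast+

lemma rsub_neg: "rsub N \<Longrightarrow> a \<in> N \<Longrightarrow> \<ominus> a \<in> N"
  using rsubD(4)[of N "\<ominus> \<one>" a] rsubD(1)[of N a] by (simp add: R_neg l_minus)

lemma rsub_diff: "rsub N \<Longrightarrow> a \<in> N \<Longrightarrow> b \<in> N \<Longrightarrow> a \<ominus> b \<in> N"
  by (simp add: minus_eq rsub_neg rsubD)

lemma rsub_R: "rsub (carrier R)"
  by (intro rsubI) (auto intro: R_sub R_mult R_add)

lemma rsub_inter: "rsub A \<Longrightarrow> rsub B \<Longrightarrow> rsub (A \<inter> B)"
  unfolding rsub_def by blast

section \<open>Sums, multiples and colons of submodules\<close>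

definition ssum :: "'a set \<Rightarrow> 'a set \<Rightarrow> 'a set" (infixl \<open>\<^bold>+\<close> 65) where
  "A \<^bold>+ B = {a \<oplus> b | a b. a \<in> A \<and> b \<in> B}"

definition scale :: "'a \<Rightarrow> 'a set \<Rightarrow> 'a set" (infixr \<open>\<^bold>*\<close> 70) where
  "z \<^bold>* B = {z \<otimes> b | b. b \<in> B}"

lemma ssum_mem: "a \<in> A \<Longrightarrow> b \<in> B \<Longrightarrow> a \<oplus> b \<in> A \<^bold>+ B"
  unfolding ssum_def by blast

lemma ssum_memE:
  assumes "q \<in> A \<^bold>+ B" obtains a b where "a \<in> A" "b \<in> B" "q = a \<oplus> b"
  using assms unfolding ssum_def by blast

lemma scale_mem: "b \<in> B \<Longrightarrow> z \<otimes> b \<in> z \<^bold>* B"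
  unfolding scale_def by blast

lemma scale_memE:
  assumes "q \<in> z \<^bold>* B" obtains b where "b \<in> B" "q = z \<otimes> b"
  using assms unfolding scale_def by blast

lemma rsub_ssum:
  assumes "rsub A" "rsub B" shows "rsub (A \<^bold>+ B)"
proof (rule rsubI)
  note A = rsubD[OF assms(1)] and B = rsubD[OF assms(2)]
  show "A \<^bold>+ B \<subseteq> carrier Q" using A(1) B(1) by (auto elim!: ssum_memE)
  show "\<zero> \<in> A \<^bold>+ B" using ssum_mem[OF A(2) B(2)] by simp
  show "p \<oplus> q \<in> A \<^bold>+ B" if pq: "p \<in> A \<^bold>+ B" "q \<in> A \<^bold>+ B" for p q
  proof -
    obtain a b where ab: "a \<in> A" "b \<in> B" "p = a \<oplus> b" using pq(1) by (rule ssum_memE)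
    obtain c d where cd: "c \<in> A" "d \<in> B" "q = c \<oplus> d" using pq(2) by (rule ssum_memE)
    have "p \<oplus> q = (a \<oplus> c) \<oplus> (b \<oplus> d)"
      using ab cd A(1) B(1) by (simp add: a_ac)
    then show ?thesis using ab cd A(3) B(3) by (simp add: ssum_mem)
  qed
  show "r \<otimes> q \<in> A \<^bold>+ B" if r: "r \<in> carrier R" "q \<in> A \<^bold>+ B" for r q
  proof -
    obtain a b where ab: "a \<in> A" "b \<in> B" "q = a \<oplus> b" using r(2) by (rule ssum_memE)
    have "r \<otimes> q = (r \<otimes> a) \<oplus> (r \<otimes> b)"
      using ab A(1) B(1) R_sub[OF r(1)] by (simp add: r_distr)
    then show ?thesis using ab r A(4) B(4) by (simp add: ssum_mem)
  qed
qed

lemma ssum_ge1: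
  assumes "rsub A" "rsub B" shows "A \<subseteq> A \<^bold>+ B"
proof
  fix a assume "a \<in> A"
  then show "a \<in> A \<^bold>+ B" using ssum_mem[of a A \<zero> B] rsubD(1,2) assms by fastforce
qed

lemma ssum_ge2:
  assumes "rsub A" "rsub B" shows "B \<subseteq> A \<^bold>+ B"
proof
  fix b assume "b \<in> B"
  then show "b \<in> A \<^bold>+ B" using ssum_mem[of \<zero> A b B] rsubD(1,2) assms by fastforce
qed

lemma ssum_least: "rsub C \<Longrightarrow> A \<subseteq> C \<Longrightarrow> B \<subseteq> C \<Longrightarrow> A \<^bold>+ B \<subseteq> C"
  by (auto elim!: ssum_memE dest: rsubD(3))

lemma rsub_scale:
  assumes "rsub B" "z \<in> carrier Q" shows "rsub (z \<^bold>* B)"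
proof (rule rsubI)
  note B = rsubD[OF assms(1)]
  show "z \<^bold>* B \<subseteq> carrier Q" using B(1) assms(2) by (auto elim!: scale_memE)
  show "\<zero> \<in> z \<^bold>* B" using scale_mem[OF B(2), of z] assms(2) by simp
  show "p \<oplus> q \<in> z \<^bold>* B" if pq: "p \<in> z \<^bold>* B" "q \<in> z \<^bold>* B" for p q
  proof -
    obtain a where a: "a \<in> B" "p = z \<otimes> a" using pq(1) by (rule scale_memE)
    obtain b where b: "b \<in> B" "q = z \<otimes> b" using pq(2) by (rule scale_memE)
    have "p \<oplus> q = z \<otimes> (a \<oplus> b)" using a b B(1) assms(2) by (simp add: r_distr)
    then show ?thesis using a b B(3) by (simp add: scale_mem)
  qed
  show "r \<otimes> q \<in> z \<^bold>* B" if r: "r \<in> carrier R" "q \<in> z \<^bold>* B" for r q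
  proof -
    obtain b where b: "b \<in> B" "q = z \<otimes> b" using r(2) by (rule scale_memE)
    have "r \<otimes> q = z \<otimes> (r \<otimes> b)" using b B(1) assms(2) R_sub[OF r(1)] by (simp add: m_lcomm)
    then show ?thesis using b r B(4) by (simp add: scale_mem)
  qed
qed

text \<open>The kernel of multiplication by \<open>z\<close> from \<open>B\<close> to
  \<open>Q / A\<close>; it governs the length of \<open>(A + zB) / A\<close>.\<close>

lemma rsub_colon_elem:
  assumes "rsub A" "rsub B" "z \<in> carrier Q" shows "rsub {b \<in> B. z \<otimes> b \<in> A}"
proof (rule rsubI)
  note A = rsubD[OF assms(1)] and B = rsubD[OF assms(2)]
  show "p \<oplus> q \<in> {b \<in> B. z \<otimes> b \<in> A}" if "p \<in> {b \<in> B. z \<otimes> b \<in> A}" "q \<in> {b \<in> B. z \<otimes> b \<in> A}" for p q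
    using that A B assms(3) by (auto simp: r_distr)
  show "r \<otimes> q \<in> {b \<in> B. z \<otimes> b \<in> A}" if "r \<in> carrier R" "q \<in> {b \<in> B. z \<otimes> b \<in> A}" for r q
    using that A(4) B(1,4) assms(3) R_sub by (auto simp: m_lcomm[of z])
qed (use rsubD[OF assms(1)] rsubD[OF assms(2)] assms(3) in auto)

lemma rsub_colon:
  assumes "rsub A" "N \<subseteq> carrier Q" shows "rsub (colon Q A N)"
proof (rule rsubI)
  note A = rsubD[OF assms(1)]
  show "colon Q A N \<subseteq> carrier Q" unfolding colon_def by blast
  show "\<zero> \<in> colon Q A N" unfolding colon_def using A(2) assms(2) by auto
  show "p \<oplus> q \<in> colon Q A N" if "p \<in> colon Q A N" "q \<in> colon Q A N" for p q
    using that A(3) assms(2) unfolding colon_def by (auto simp: l_distr subset_iff)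
  show "r \<otimes> q \<in> colon Q A N" if "r \<in> carrier R" "q \<in> colon Q A N" for r q
    using that A(4) assms(2) R_sub unfolding colon_def by (auto simp: m_assoc subset_iff)
qed

text \<open>The length of \<open>B / A\<close> when \<open>A \<subseteq> B\<close>, read off the
  modules in between, so that no quotient module has to be formed.\<close>

definition len :: "'a set \<Rightarrow> 'a set \<Rightarrow> enat" where
  "len A B = height {N. rsub N \<and> A \<subseteq> N \<and> N \<subseteq> B}"

lemma len_mono: "A' \<subseteq> A \<Longrightarrow> B \<subseteq> B' \<Longrightarrow> len A B \<le> len A' B'"
  unfolding len_def by (rule height_mono_map[where f = "\<lambda>N. N"]) auto

lemma len_ge_1:
  assumes "rsub A" "rsub B" "A \<subset> B" shows "1 \<le> len A B"
proof -
  have "enat 1 \<le> len A B"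
    unfolding len_def by (rule height_ge[where N = "\<lambda>i. if i = 0 then A else B"]) (use assms in auto)
  then show ?thesis by (simp add: one_enat_def)
qed

lemma len_add_ge:
  assumes "rsub A" "rsub B" "rsub C" "A \<subseteq> B" "B \<subseteq> C"
  shows "len A B + len B C \<le> len A C"
proof (rule enat_add_le_via_nat)
  fix n k assume n: "enat n \<le> len A B" and k: "enat k \<le> len B C"
  obtain N where N: "\<And>i. i \<le> n \<Longrightarrow> rsub (N i) \<and> A \<subseteq> N i \<and> N i \<subseteq> B" "\<And>i. i < n \<Longrightarrow> N i \<subset> N (Suc i)"
    using n unfolding len_def by (rule height_geE) (use assms in auto)
  obtain M where M: "\<And>i. i \<le> k \<Longrightarrow> rsub (M i) \<and> B \<subseteq> M i \<and> M i \<subseteq> C" "\<And>i. i < k \<Longrightarrow> M i \<subset> M (Suc i)"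
    using k unfolding len_def by (rule height_geE) (use assms in auto)
  \<comment> \<open>\<open>M 0\<close> is left out at the seam:
    \<open>N n \<subseteq> B \<subseteq> M 0 \<subset> M 1\<close> keeps the step from
    \<open>n\<close> to \<open>n + 1\<close> strict and the total number of steps
    \<open>n + k\<close>.\<close>
  let ?P = "\<lambda>i. if i \<le> n then N i else M (i - n)"
  have "?P i \<subset> ?P (Suc i)" if "i < n + k" for i
  proof (cases "i < n")
    case False
    then have "?P i \<subseteq> M (i - n)" using N(1)[of n] M(1)[of 0] by (cases "i = n") auto
    also have "\<dots> \<subset> M (Suc (i - n))" using False that by (intro M(2)) auto
    finally show ?thesis using False by (simp add: Suc_diff_le)
  qed (use N(2) in auto)
  moreover have "?P i \<in> {N. rsub N \<and> A \<subseteq> N \<and> N \<subseteq> C}" if "i \<le> n + k" for i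
  proof (cases "i \<le> n")
    case False
    then have "rsub (M (i - n)) \<and> B \<subseteq> M (i - n) \<and> M (i - n) \<subseteq> C" using that by (intro M(1)) auto
    then show ?thesis using False assms by auto
  qed (use N(1)[of i] assms in auto)
  ultimately show "enat (n + k) \<le> len A C"
    unfolding len_def by (intro height_ge[where N = ?P]) blast+
qed

lemma len_Suc_le:
  assumes "rsub A" "rsub B" "rsub C" "A \<subseteq> B" "B \<subset> C"
  shows "len A B + 1 \<le> len A C"
proof -
  have "len A B + 1 \<le> len A B + len B C" using len_ge_1[of B C] assms by (intro add_left_mono) auto
  also have "\<dots> \<le> len A C" using assms by (intro len_add_ge) auto
  finally show ?thesis .
qed

text \<open>Modular law: if \<open>b \<in> B\<close> is written \<open>a + c\<close> with
  \<open>a \<in> A\<close> and \<open>c \<in> C\<close>, then \<open>c = b - a\<close> lies in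
  \<open>B \<inter> C = A \<inter> C\<close>.\<close>

lemma modular_eq:
  assumes "rsub A" "rsub B" "rsub C" "A \<subseteq> B" "A \<inter> C = B \<inter> C" "A \<^bold>+ C = B \<^bold>+ C"
  shows "A = B"
proof
  show "B \<subseteq> A"
  proof
    fix b assume b: "b \<in> B"
    then have "b \<in> A \<^bold>+ C" using ssum_ge1[of B C] assms by blast
    then obtain a c where ac: "a \<in> A" "c \<in> C" "b = a \<oplus> c" by (rule ssum_memE)
    have car: "a \<in> carrier Q" "c \<in> carrier Q" using ac assms rsubD(1) by blast+
    have "c = b \<ominus> a" using car unfolding ac(3) by algebra
    then have "c \<in> B" using rsub_diff[of B b a] b ac assms by blast
    then have "c \<in> A" using ac(2) assms(5) by blast
    then show "b \<in> A" using ac rsubD(3)[of A] assms by blast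
  qed
qed fact

lemma ssum_mono: "A \<subseteq> A' \<Longrightarrow> B \<subseteq> B' \<Longrightarrow> A \<^bold>+ B \<subseteq> A' \<^bold>+ B'"
  unfolding ssum_def by blast

lemma len_add:
  assumes "rsub A" "rsub B" "rsub C" "A \<subseteq> B" "B \<subseteq> C"
  shows "len A C = len A B + len B C"
proof (rule antisym)
  show "len A C \<le> len A B + len B C"
    unfolding len_def[of A C]
  proof (rule height_leI)
    fix n and N :: "nat \<Rightarrow> 'a set"
    assume N: "\<And>i. i \<le> n \<Longrightarrow> N i \<in> {N. rsub N \<and> A \<subseteq> N \<and> N \<subseteq> C}" "\<And>i. i < n \<Longrightarrow> N i \<subset> N (Suc i)"
    \<comment> \<open>By the modular law each strict step \<open>N i \<subset> N (Suc i)\<close> is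
      still strict after intersecting with \<open>B\<close> or after adding \<open>B\<close>. Hence
      \<open>?h\<close> grows by at least one per step, and no composition series is needed.\<close>
    let ?h = "\<lambda>i. len A (N i \<inter> B) + len B (N i \<^bold>+ B)"
    have I: "rsub (N i \<inter> B)" "A \<subseteq> N i \<inter> B" and S: "rsub (N i \<^bold>+ B)" "B \<subseteq> N i \<^bold>+ B"
      if "i \<le> n" for i
      using N(1)[OF that] assms ssum_ge2[of "N i" B] by (auto intro: rsub_inter rsub_ssum)
    have "enat i \<le> ?h i" if "i \<le> n" for i
      using that
    proof (induction i)
      case (Suc i)
      have "N i \<subset> N (Suc i)" using N(2)[of i] Suc.prems by simp
      then have sub: "N i \<inter> B \<subseteq> N (Suc i) \<inter> B" "N i \<^bold>+ B \<subseteq> N (Suc i) \<^bold>+ B"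
        by (blast, intro ssum_mono) auto
      have "N i \<inter> B \<noteq> N (Suc i) \<inter> B \<or> N i \<^bold>+ B \<noteq> N (Suc i) \<^bold>+ B"
        using modular_eq[of "N i" "N (Suc i)" B] N(1)[of i] N(1)[of "Suc i"] N(2)[of i] Suc.prems assms
        by auto
      then have "?h i + 1 \<le> ?h (Suc i)"
      proof
        assume "N i \<inter> B \<noteq> N (Suc i) \<inter> B"
        then have "len A (N i \<inter> B) + 1 \<le> len A (N (Suc i) \<inter> B)"
          using sub I[of i] I[of "Suc i"] Suc.prems assms by (intro len_Suc_le) auto
        moreover have "len B (N i \<^bold>+ B) \<le> len B (N (Suc i) \<^bold>+ B)" using sub by (intro len_mono) auto
        ultimately have "(len A (N i \<inter> B) + 1) + len B (N i \<^bold>+ B) \<le> ?h (Suc i)" by (rule add_mono)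
        then show ?thesis by (simp add: ac_simps)
      next
        assume "N i \<^bold>+ B \<noteq> N (Suc i) \<^bold>+ B"
        then have "len B (N i \<^bold>+ B) + 1 \<le> len B (N (Suc i) \<^bold>+ B)"
          using sub S[of i] S[of "Suc i"] Suc.prems assms by (intro len_Suc_le) auto
        moreover have "len A (N i \<inter> B) \<le> len A (N (Suc i) \<inter> B)" using sub by (intro len_mono) auto
        ultimately have "len A (N i \<inter> B) + (len B (N i \<^bold>+ B) + 1) \<le> ?h (Suc i)" by (intro add_mono)
        then show ?thesis by (simp add: ac_simps)
      qed
      moreover have "enat i + 1 \<le> ?h i + 1" using Suc by (intro add_right_mono) auto
      ultimately have "enat i + 1 \<le> ?h (Suc i)" by (rule order_trans[rotated])
      then show ?case by (simp add: one_enat_def)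
    qed (simp add: zero_enat_def[symmetric])
    then have "enat n \<le> ?h n" by simp
    also have "?h n \<le> len A B + len B C"
      using N(1)[of n] assms by (intro add_mono len_mono ssum_least) auto
    finally show "enat n \<le> len A B + len B C" .
  qed
qed (use len_add_ge assms in blast)

lemma len_refl: "rsub A \<Longrightarrow> len A A = 0"
proof -
  assume "rsub A"
  have "len A A \<le> 0" unfolding len_def
  proof (rule height_leI)
    fix n and N :: "nat \<Rightarrow> 'a set"
    assume "\<And>i. i \<le> n \<Longrightarrow> N i \<in> {N. rsub N \<and> A \<subseteq> N \<and> N \<subseteq> A}" "\<And>i. i < n \<Longrightarrow> N i \<subset> N (Suc i)"
    from this(1)[of 0] this(1)[of 1] this(2)[of 0] show "enat n \<le> 0"
      by (cases n) (auto simp: zero_enat_def)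
  qed
  then show ?thesis by simp
qed

text \<open>Every module between \<open>A\<close> and \<open>A + zB\<close> is recovered from its
  preimage under \<open>b \<mapsto> zb\<close>, so taking preimages is strictly monotone. With the
  next inequality this is the isomorphism of \<open>(A + zB) / A\<close> with \<open>B\<close>
  modulo the kernel.\<close>

lemma len_sum_le:
  assumes "rsub A" "rsub B" "z \<in> carrier Q"
  shows "len A (A \<^bold>+ (z \<^bold>* B)) \<le> len {b \<in> B. z \<otimes> b \<in> A} B"
  unfolding len_def
proof (rule height_mono_map[where f = "\<lambda>N. {b \<in> B. z \<otimes> b \<in> N}"])
  fix N assume "N \<in> {N. rsub N \<and> A \<subseteq> N \<and> N \<subseteq> A \<^bold>+ (z \<^bold>* B)}"
  then show "{b \<in> B. z \<otimes> b \<in> N} \<in> {N. rsub N \<and> {b \<in> B. z \<otimes> b \<in> A} \<subseteq> N \<and> N \<subseteq> B}"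
    using rsub_colon_elem[of N B z] assms by auto
next
  fix N N' assume N: "N \<in> {N. rsub N \<and> A \<subseteq> N \<and> N \<subseteq> A \<^bold>+ (z \<^bold>* B)}"
    "N' \<in> {N. rsub N \<and> A \<subseteq> N \<and> N \<subseteq> A \<^bold>+ (z \<^bold>* B)}" "N \<subset> N'"
  then obtain q where q: "q \<in> N'" "q \<notin> N" by blast
  then have "q \<in> A \<^bold>+ (z \<^bold>* B)" using N by blast
  then obtain a b where ab: "a \<in> A" "b \<in> B" "q = a \<oplus> z \<otimes> b" by (auto elim!: ssum_memE scale_memE)
  have car: "a \<in> carrier Q" "b \<in> carrier Q" using ab assms rsubD(1) by blast+
  have "z \<otimes> b = q \<ominus> a" using car assms(3) unfolding ab(3) by algebra
  moreover have "q \<ominus> a \<in> N'" using q(1) N ab(1) by (intro rsub_diff) auto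
  ultimately have "z \<otimes> b \<in> N'" by simp
  moreover have "z \<otimes> b \<notin> N" using q(2) ab N rsubD(3)[of N a "z \<otimes> b"] by blast
  ultimately show "{b \<in> B. z \<otimes> b \<in> N} \<subset> {b \<in> B. z \<otimes> b \<in> N'}" using N(3) ab(2) by blast
qed

text \<open>In the other direction \<open>N \<mapsto> A + zN\<close> is strictly monotone on modules
  that contain the kernel: if \<open>zq = a + zp\<close>, then \<open>q - p\<close> is in the kernel
  and so in \<open>N\<close>.\<close>

lemma len_sum_ge:
  assumes "rsub A" "rsub B" "z \<in> carrier Q"
  shows "len {b \<in> B. z \<otimes> b \<in> A} B \<le> len A (A \<^bold>+ (z \<^bold>* B))"
  unfolding len_def
proof (rule height_mono_map[where f = "\<lambda>N. A \<^bold>+ (z \<^bold>* N)"])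
  fix N assume N: "N \<in> {N. rsub N \<and> {b \<in> B. z \<otimes> b \<in> A} \<subseteq> N \<and> N \<subseteq> B}"
  then have "z \<^bold>* N \<subseteq> z \<^bold>* B" unfolding scale_def by blast
  then show "A \<^bold>+ (z \<^bold>* N) \<in> {N. rsub N \<and> A \<subseteq> N \<and> N \<subseteq> A \<^bold>+ (z \<^bold>* B)}"
    using N assms rsub_scale[of N z] ssum_ge1[of A "z \<^bold>* N"] rsub_ssum[of A "z \<^bold>* N"]
      ssum_mono[of A A "z \<^bold>* N" "z \<^bold>* B"]
    by blast
next
  fix N N' assume N: "N \<in> {N. rsub N \<and> {b \<in> B. z \<otimes> b \<in> A} \<subseteq> N \<and> N \<subseteq> B}"
    "N' \<in> {N. rsub N \<and> {b \<in> B. z \<otimes> b \<in> A} \<subseteq> N \<and> N \<subseteq> B}" "N \<subset> N'"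
  then obtain q where q: "q \<in> N'" "q \<notin> N" by blast
  have sub: "A \<^bold>+ (z \<^bold>* N) \<subseteq> A \<^bold>+ (z \<^bold>* N')"
    using N(3) by (intro ssum_mono) (auto simp: scale_def)
  have "z \<otimes> q \<in> A \<^bold>+ (z \<^bold>* N')"
    using ssum_ge2[of A "z \<^bold>* N'"] N q(1) assms rsub_scale[of N' z] scale_mem[of q N' z] by blast
  moreover have "z \<otimes> q \<notin> A \<^bold>+ (z \<^bold>* N)"
  proof
    assume "z \<otimes> q \<in> A \<^bold>+ (z \<^bold>* N)"
    then obtain a p where ap: "a \<in> A" "p \<in> N" "z \<otimes> q = a \<oplus> z \<otimes> p" by (auto elim!: ssum_memE scale_memE)
    have car: "a \<in> carrier Q" "p \<in> carrier Q" "q \<in> carrier Q"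
      using ap assms rsubD(1) N q by blast+
    have "z \<otimes> (q \<ominus> p) = z \<otimes> q \<ominus> z \<otimes> p" using car assms(3) by algebra
    also have "\<dots> = a" using car assms(3) unfolding ap(3) by algebra
    finally have "q \<ominus> p \<in> N" using ap N q rsub_diff[of B q p] assms by blast
    then have "(q \<ominus> p) \<oplus> p \<in> N" using ap N rsubD(3)[of N] by blast
    moreover have "(q \<ominus> p) \<oplus> p = q" using car by algebra
    ultimately show False using q by simp
  qed
  ultimately show "A \<^bold>+ (z \<^bold>* N) \<subset> A \<^bold>+ (z \<^bold>* N')" using sub by blast
qed

lemma scale_mono: "A \<subseteq> B \<Longrightarrow> z \<^bold>* A \<subseteq> z \<^bold>* B"
  unfolding scale_def by blast

lemma scale_inv:
  assumes "u \<in> Units Q" "A \<subseteq> carrier Q"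
  shows "inv u \<^bold>* (u \<^bold>* A) = A" "u \<^bold>* (inv u \<^bold>* A) = A"
proof -
  have "inv u \<otimes> (u \<otimes> a) = a" "u \<otimes> (inv u \<otimes> a) = a" if "a \<in> A" for a
  proof -
    have "a \<in> carrier Q" using assms(2) that by blast
    then have "inv u \<otimes> (u \<otimes> a) = a \<and> u \<otimes> (inv u \<otimes> a) = a"
      using assms(1) by (simp add: m_assoc[symmetric] Units_closed)
    then show "inv u \<otimes> (u \<otimes> a) = a" "u \<otimes> (inv u \<otimes> a) = a" by auto
  qed
  then show "inv u \<^bold>* (u \<^bold>* A) = A" "u \<^bold>* (inv u \<^bold>* A) = A" unfolding scale_def by force+
qed

text \<open>Multiplication by a unit is injective on submodules; one inequality, applied to
  \<open>u\<close> and to \<open>inv u\<close>, gives equality.\<close>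

lemma len_scale:
  assumes "u \<in> Units Q" "A \<subseteq> carrier Q" "B \<subseteq> carrier Q"
  shows "len (u \<^bold>* A) (u \<^bold>* B) = len A B"
proof -
  have le: "len A B \<le> len (u \<^bold>* A) (u \<^bold>* B)" if "u \<in> Units Q" for u A B
    unfolding len_def
  proof (rule height_mono_map[where f = "\<lambda>N. u \<^bold>* N"])
    fix N N' assume N: "N \<in> {N. rsub N \<and> A \<subseteq> N \<and> N \<subseteq> B}" "N' \<in> {N. rsub N \<and> A \<subseteq> N \<and> N \<subseteq> B}" "N \<subset> N'"
    then have "N \<subseteq> carrier Q" "N' \<subseteq> carrier Q" unfolding rsub_def by auto
    then have "u \<^bold>* N \<noteq> u \<^bold>* N'" using scale_inv[OF that] N(3) by (metis psubset_eq)
    then show "u \<^bold>* N \<subset> u \<^bold>* N'" using N(3) scale_mono[of N N'] by auto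
  qed (use that scale_mono rsub_scale in auto)
  show ?thesis
    using le[OF assms(1), of A B] le[OF Units_inv_Units[OF assms(1)], of "u \<^bold>* A" "u \<^bold>* B"]
    by (simp add: scale_inv assms)
qed

text \<open>The generators are adjoined one at a time. Each adds a cyclic module annihilated by
  \<open>I\<close>, whose length is at most that of \<open>R / I\<close>.\<close>

lemma adjoin_generators:
  assumes "finite G" "G \<subseteq> carrier Q" "rsub A" "I \<subseteq> carrier R" "\<And>g a. g \<in> G \<Longrightarrow> a \<in> I \<Longrightarrow> a \<otimes> g \<in> A"
  shows "\<exists>B. rsub B \<and> A \<subseteq> B \<and> G \<subseteq> B \<and> len A B \<le> of_nat (card G) * len I (carrier R)"
  using assms
proof (induction rule: finite_induct)
  case empty
  then show ?case using len_refl by (intro exI[of _ A]) auto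
next
  case (insert g G)
  then obtain B where B: "rsub B" "A \<subseteq> B" "G \<subseteq> B" "len A B \<le> of_nat (card G) * len I (carrier R)"
    by auto
  let ?C = "B \<^bold>+ (g \<^bold>* carrier R)"
  have g: "g \<in> carrier Q" using insert.prems by simp
  have C: "rsub ?C" "B \<subseteq> ?C" "g \<^bold>* carrier R \<subseteq> ?C"
    using rsub_ssum ssum_ge1 ssum_ge2 B(1) rsub_scale[OF rsub_R g] by auto
  have "len B ?C \<le> len {b \<in> carrier R. g \<otimes> b \<in> B} (carrier R)"
    by (rule len_sum_le[OF B(1) rsub_R g])
  also have "\<dots> \<le> len I (carrier R)"
  proof (intro len_mono subsetI CollectI conjI)
    fix a assume a: "a \<in> I"
    then have "a \<otimes> g \<in> A" "a \<in> carrier R" using insert.prems by auto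
    then show "g \<otimes> a \<in> B" "a \<in> carrier R" using B(2) g R_sub[of a] by (auto simp: m_comm[of g])
  qed
  finally have *: "len B ?C \<le> len I (carrier R)" .
  have "len A ?C = len A B + len B ?C" using len_add[of A B ?C] insert.prems B C by blast
  also have "\<dots> \<le> of_nat (card G) * len I (carrier R) + len I (carrier R)"
    by (intro add_mono B(4) *)
  also have "\<dots> = of_nat (card (insert g G)) * len I (carrier R)"
    using insert.hyps by (simp add: distrib_right add.commute)
  finally have "len A ?C \<le> of_nat (card (insert g G)) * len I (carrier R)" .
  moreover have "g \<in> ?C" using C(3) scale_mem[of \<one> "carrier R" g] g by auto
  ultimately show ?case using B C by (intro exI[of _ ?C]) auto
qed

end

section \<open>Comparison with ideals, submodules and module length\<close>

lemma module_ring_module: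
  assumes "cring R" "cring B" "\<phi> \<in> ring_hom R B"
  shows "module R (ring_module B \<phi>)"
proof -
  interpret B: cring B by fact
  interpret R: cring R by fact
  have "abelian_group (ring_module B \<phi>)"
    by (rule abelian_groupI) (auto simp: ring_module_def B.a_ac intro!: bexI[of _ "\<ominus>\<^bsub>B\<^esub> _"] B.l_neg)
  then show ?thesis
    using assms(3) R.cring_axioms
    by (intro module.intro module_axioms.intro)
      (auto simp: ring_module_def ring_hom_closed ring_hom_add ring_hom_mult ring_hom_one
        B.l_distr B.r_distr B.m_assoc)
qed

context overring
begin

lemma neg_R [simp]: "r \<in> carrier R \<Longrightarrow> \<ominus>\<^bsub>R\<^esub> r = \<ominus> r"
proof -
  interpret R: cring R by (rule cring_R)
  assume r: "r \<in> carrier R"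
  then have "\<ominus> r \<oplus>\<^bsub>R\<^esub> r = \<zero>\<^bsub>R\<^esub>" using R_sub by (simp add: l_neg)
  then show ?thesis using r by (intro R.minus_equality) (auto simp: R_neg)
qed

lemma minus_R [simp]: "r \<in> carrier R \<Longrightarrow> s \<in> carrier R \<Longrightarrow> r \<ominus>\<^bsub>R\<^esub> s = r \<ominus> s"
  by (simp add: a_minus_def)

lemma ideal_iff_rsub: "ideal I R \<longleftrightarrow> rsub I \<and> I \<subseteq> carrier R"
proof
  interpret R: cring R by (rule cring_R)
  assume I: "ideal I R"
  then interpret I: ideal I R .
  show "rsub I \<and> I \<subseteq> carrier R"
  proof
    show "rsub I"
    proof (rule rsubI)
      show "\<zero> \<in> I" using I.zero_closed by simp
      show "a \<oplus> b \<in> I" if "a \<in> I" "b \<in> I" for a b using I.a_closed[OF that] by simp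
      show "r \<otimes> a \<in> I" if "r \<in> carrier R" "a \<in> I" for r a using I.I_l_closed[OF that(2,1)] by simp
    qed (use I.a_subset R_sub in blast)
  qed (rule I.a_subset)
next
  interpret R: cring R by (rule cring_R)
  assume I: "rsub I \<and> I \<subseteq> carrier R"
  show "ideal I R"
  proof (rule idealI)
    show "subgroup I (add_monoid R)"
      using I rsubD[of I] rsub_neg[of I]
      by (intro R.add.subgroupI) (auto simp: a_inv_def[symmetric])
    show "a \<otimes>\<^bsub>R\<^esub> r \<in> I" if "a \<in> I" "r \<in> carrier R" for a r
      using rsubD(4)[of I r a] rsubD(1)[of I a] I that R_sub[of r] by (simp add: m_comm)
  qed (use I rsubD(4) R.ring_axioms in auto)
qed

lemma submodule_iff_rsub:
  "LinearCombinations.submodule R N (ring_module Q (\<lambda>a. a)) \<longleftrightarrow> rsub N"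
proof -
  have "(\<lambda>a. a) \<in> ring_hom R Q" by (rule ring_hom_memI) (auto simp: R_sub)
  then have "module R (ring_module Q (\<lambda>a. a))"
    using module_ring_module cring_R cring_axioms by blast
  then show ?thesis
    unfolding submodule_def rsub_def by (auto simp: ring_module_def)
qed

text \<open>The correspondence theorem: preimages and images under
  \<open>R \<rightarrow> R / I\<close> are strictly monotone between submodules of
  \<open>R / I\<close> and ideals above \<open>I\<close>, which gives both inequalities.\<close>

lemma module_length_quotient:
  assumes "ideal I R"
  shows "module_length R (quotient_module R I) = len I (carrier R)"
proof -
  interpret R: cring R by (rule cring_R)
  interpret I: ideal I R by fact
  let ?M = "quotient_module R I" and ?h = "\<lambda>r. I +>\<^bsub>R\<^esub> r"
  have carr: "carrier ?M = ?h ` carrier R"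
    unfolding quotient_module_def ring_module_def FactRing_def A_RCOSETS_def'
    by auto
  have M_simps: "add ?M = add (R Quot I)" "\<zero>\<^bsub>?M\<^esub> = \<zero>\<^bsub>R Quot I\<^esub>"
    "\<And>r c. r \<odot>\<^bsub>?M\<^esub> c = ?h r \<otimes>\<^bsub>R Quot I\<^esub> c"
    unfolding quotient_module_def ring_module_def by auto
  have hom: "?h \<in> ring_hom R (R Quot I)" by (rule I.rcos_ring_hom)
  have mod: "module R ?M"
    unfolding quotient_module_def
    by (intro module_ring_module cring_R I.quotient_is_cring hom)
  have h_add: "?h r \<oplus>\<^bsub>?M\<^esub> ?h s = ?h (r \<oplus> s)" and h_smult: "r \<odot>\<^bsub>?M\<^esub> ?h s = ?h (r \<otimes> s)"
    if "r \<in> carrier R" "s \<in> carrier R" for r s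
    using ring_hom_add[OF hom that] ring_hom_mult[OF hom that] by (simp_all add: M_simps)
  have h_zero: "\<zero>\<^bsub>?M\<^esub> = ?h \<zero>" using ring_hom_zero[OF hom R.ring_axioms] I.quotient_is_ring by (simp add: M_simps)
  have h_I: "?h r = \<zero>\<^bsub>?M\<^esub>" if "r \<in> I" for r
    using R.a_rcos_zero[OF assms that] R.a_rcos_zero[OF assms I.zero_closed] h_zero by simp
  have h_eq: "r \<ominus> s \<in> I" if "?h r = ?h s" "r \<in> carrier R" "s \<in> carrier R" for r s
    using R.quotient_eq_iff_same_a_r_cos[OF assms that(2,3)] that by simp
  have "height {N. LinearCombinations.submodule R N ?M} \<le> len I (carrier R)"
    unfolding len_def
  proof (rule height_mono_map[where f = "\<lambda>N. {r \<in> carrier R. ?h r \<in> N}"])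
    fix N assume "N \<in> {N. LinearCombinations.submodule R N ?M}"
    then have N: "LinearCombinations.submodule R N ?M" by simp
    have "rsub {r \<in> carrier R. ?h r \<in> N}"
    proof (rule rsubI)
      show "a \<oplus> b \<in> {r \<in> carrier R. ?h r \<in> N}"
        if "a \<in> {r \<in> carrier R. ?h r \<in> N}" "b \<in> {r \<in> carrier R. ?h r \<in> N}" for a b
        using that submodule.m_closed[OF N, of "?h a" "?h b"] h_add[of a b] R_add by auto
      show "r \<otimes> a \<in> {r \<in> carrier R. ?h r \<in> N}"
        if "r \<in> carrier R" "a \<in> {r \<in> carrier R. ?h r \<in> N}" for r a
        using that submodule.smult_closed[OF N, of r "?h a"] h_smult[of r a] R_mult by auto
    qed (use R_sub submodule.zero_closed[OF N] h_zero in auto)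
    then show "{r \<in> carrier R. ?h r \<in> N} \<in> {N. rsub N \<and> I \<subseteq> N \<and> N \<subseteq> carrier R}"
      using h_I submodule.zero_closed[OF N] I.a_subset by auto
  next
    fix N N' assume N: "N \<in> {N. LinearCombinations.submodule R N ?M}"
      "N' \<in> {N. LinearCombinations.submodule R N ?M}" "N \<subset> N'"
    then obtain c where c: "c \<in> N'" "c \<notin> N" by blast
    then have "c \<in> carrier ?M" using N(2) submodule.subset by blast
    then obtain r where "r \<in> carrier R" "c = ?h r" unfolding carr by blast
    then show "{r \<in> carrier R. ?h r \<in> N} \<subset> {r \<in> carrier R. ?h r \<in> N'}" using c N(3) by blast
  qed
  moreover have "len I (carrier R) \<le> height {N. LinearCombinations.submodule R N ?M}"
    unfolding len_def
  proof (rule height_mono_map[where f = "\<lambda>J. ?h ` J"])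
    fix J assume "J \<in> {N. rsub N \<and> I \<subseteq> N \<and> N \<subseteq> carrier R}"
    then have J: "rsub J" "I \<subseteq> J" "J \<subseteq> carrier R" by auto
    have "LinearCombinations.submodule R (?h ` J) ?M"
    proof (rule submodule.intro[OF mod])
      show "?h ` J \<subseteq> carrier ?M" using J(3) unfolding carr by blast
      show "v \<oplus>\<^bsub>?M\<^esub> w \<in> ?h ` J" if "v \<in> ?h ` J" "w \<in> ?h ` J" for v w
        using that J(3) rsubD(3)[OF J(1)] h_add by (auto simp: subset_iff)
      show "\<zero>\<^bsub>?M\<^esub> \<in> ?h ` J" using rsubD(2)[OF J(1)] h_zero by auto
      show "c \<odot>\<^bsub>?M\<^esub> v \<in> ?h ` J" if "c \<in> carrier R" "v \<in> ?h ` J" for c v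
        using that J(3) rsubD(4)[OF J(1)] h_smult by (auto simp: subset_iff)
    qed
    then show "?h ` J \<in> {N. LinearCombinations.submodule R N ?M}" by simp
  next
    fix J J' assume J: "J \<in> {N. rsub N \<and> I \<subseteq> N \<and> N \<subseteq> carrier R}"
      "J' \<in> {N. rsub N \<and> I \<subseteq> N \<and> N \<subseteq> carrier R}" "J \<subset> J'"
    then obtain r where r: "r \<in> J'" "r \<notin> J" by blast
    have "?h r \<notin> ?h ` J"
    proof
      assume "?h r \<in> ?h ` J"
      then obtain s where s: "s \<in> J" "?h r = ?h s" by blast
      have rs: "r \<in> carrier Q" "s \<in> carrier Q" using r s J R_sub by auto
      have "r \<ominus> s \<in> J" using h_eq[OF s(2)] s(1) r(1) J by blast
      then have "(r \<ominus> s) \<oplus> s \<in> J" using s(1) J by (auto intro: rsubD(3))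
      moreover have "(r \<ominus> s) \<oplus> s = r" using rs by algebra
      ultimately show False using r(2) by simp
    qed
    then show "?h ` J \<subset> ?h ` J'" using r(1) J(3) by blast
  qed
  ultimately show ?thesis unfolding module_length_def height_def by (simp add: antisym)
qed

end

section \<open>Integrality over a Noetherian ring\<close>

context overring
begin

text \<open>The \<open>R\<close>-span of the \<open>n\<close> powers
  \<open>1, z, ..., z^(n-1)\<close>. Thus \<open>z^n\<close> lies in \<open>powspan z n\<close>
  exactly when \<open>z\<close> satisfies a monic equation of degree \<open>n\<close> over
  \<open>R\<close>.\<close>

primrec powspan :: "'a \<Rightarrow> nat \<Rightarrow> 'a set" where
  "powspan z 0 = {\<zero>}"
| "powspan z (Suc n) = powspan z n \<^bold>+ (z [^] n) \<^bold>* carrier R"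

lemma rsub_zero: "rsub {\<zero>}"
  by (rule rsubI) (auto simp: R_sub)

lemma rsub_powspan: "z \<in> carrier Q \<Longrightarrow> rsub (powspan z n)"
  by (induction n) (auto simp: rsub_zero intro!: rsub_ssum rsub_scale rsub_R)

lemma powspan_Suc_ge: "z \<in> carrier Q \<Longrightarrow> powspan z n \<subseteq> powspan z (Suc n)"
  by (auto intro!: ssum_ge1[THEN subsetD] rsub_powspan rsub_scale rsub_R)

lemma powspan_mono: "z \<in> carrier Q \<Longrightarrow> n \<le> k \<Longrightarrow> powspan z n \<subseteq> powspan z k"
  by (rule lift_Suc_mono_le[of "powspan z"]) (auto simp: powspan_Suc_ge simp del: powspan.simps)

lemma pow_mem_powspan: "z \<in> carrier Q \<Longrightarrow> z [^] n \<in> powspan z (Suc n)"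
  using ssum_mem[of \<zero> "powspan z n" "z [^] n \<otimes> \<one>" "(z [^] n) \<^bold>* carrier R"]
    rsubD(2)[OF rsub_powspan] scale_mem[of \<one> "carrier R" "z [^] n"] by simp

lemma powspan_SucE:
  assumes "w \<in> powspan z (Suc n)"
  obtains v r where "v \<in> powspan z n" "r \<in> carrier R" "w = v \<oplus> z [^] n \<otimes> r"
  using assms by (auto elim!: ssum_memE scale_memE)

lemma powspan_SucI:
  "v \<in> powspan z n \<Longrightarrow> r \<in> carrier R \<Longrightarrow> v \<oplus> z [^] n \<otimes> r \<in> powspan z (Suc n)"
  by (auto intro!: ssum_mem scale_mem)

lemma mult_powspan: 
  assumes z: "z \<in> carrier Q"
  shows "w \<in> powspan z n \<Longrightarrow> z \<otimes> w \<in> powspan z (Suc n)"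
proof (induction n arbitrary: w)
  case 0
  then show ?case using rsubD(2)[OF rsub_powspan[OF z, of "Suc 0"]] z by auto
next
  case (Suc n)
  obtain v r where v: "v \<in> powspan z n" "r \<in> carrier R" "w = v \<oplus> z [^] n \<otimes> r"
    using Suc.prems by (rule powspan_SucE)
  have vc: "v \<in> carrier Q" using rsubD(1)[OF rsub_powspan[OF z]] v(1) by blast
  have "z \<otimes> w = z \<otimes> v \<oplus> z [^] Suc n \<otimes> r"
    using vc z R_sub[OF v(2)] unfolding v(3) by (simp add: r_distr m_ac)
  then show ?case using powspan_SucI[OF Suc.IH[OF v(1)] v(2)] by simp
qed

lemma eval_mem_powspan:
  assumes "z \<in> carrier Q"
  shows "set p \<subseteq> carrier R \<Longrightarrow> eval p z \<in> powspan z (length p)"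
proof (induction p)
  case (Cons a p)
  then have "eval p z \<oplus> z [^] length p \<otimes> a \<in> powspan z (Suc (length p))"
    by (intro powspan_SucI) auto
  moreover have "set p \<subseteq> carrier Q" using Cons R_sub by auto
  ultimately show ?case using Cons.prems R_sub assms by (simp add: eval_in_carrier m_comm a_comm del: powspan.simps)
qed simp

lemma powspan_evalE:
  assumes z: "z \<in> carrier Q" and w: "w \<in> powspan z n"
  obtains p where "set p \<subseteq> carrier R" "length p = n" "eval p z = w"
proof -
  have "\<exists>p. set p \<subseteq> carrier R \<and> length p = n \<and> eval p z = w" using w
  proof (induction n arbitrary: w)
    case (Suc n)
    obtain v r where v: "v \<in> powspan z n" "r \<in> carrier R" "w = v \<oplus> z [^] n \<otimes> r"
      using Suc.prems by (rule powspan_SucE)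
    obtain p where p: "set p \<subseteq> carrier R" "length p = n" "eval p z = v" using Suc.IH v(1) by blast
    have "v \<in> carrier Q" using rsubD(1)[OF rsub_powspan[OF z]] v(1) by blast
    then have "eval (r # p) z = w" using p v z R_sub by (simp add: m_comm a_comm)
    then show ?case using p v by (intro exI[of _ "r # p"]) auto
  qed auto
  then show ?thesis using that by blast
qed

text \<open>Moving the leading power of a monic equation to the other side turns it into membership
  in a span, and conversely.\<close>

lemma integral_closure_iff_powspan:
  "z \<in> integral_closure R Q \<longleftrightarrow> z \<in> carrier Q \<and> (\<exists>n. z [^] n \<in> powspan z n)"
proof safe
  assume "z \<in> integral_closure R Q"
  then obtain p where z: "z \<in> carrier Q"
    and p: "p \<in> carrier ((carrier R) [X]\<^bsub>Q\<^esub>)" "p \<noteq> []" "hd p = \<one>" "eval p z = \<zero>"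
    unfolding integral_closure_def by blast
  show "z \<in> carrier Q" by fact
  from p(2,3) obtain q where q: "p = \<one> # q" by (cases p) auto
  have "polynomial (carrier R) p" using p(1) by (simp add: univ_poly_carrier)
  then have set_q: "set q \<subseteq> carrier R" using q polynomial_incl by fastforce
  then have qQ: "eval q z \<in> carrier Q" using R_sub z by (intro eval_in_carrier) auto
  have "z [^] length q \<oplus> eval q z = \<zero>" using p(4) z unfolding q by simp
  then have "z [^] length q = \<ominus> eval q z" using qQ z minus_equality by simp
  then show "\<exists>n. z [^] n \<in> powspan z n"
    using rsub_neg[OF rsub_powspan[OF z] eval_mem_powspan[OF z set_q]] by metis
next
  fix n assume z: "z \<in> carrier Q" and n: "z [^] n \<in> powspan z n"
  show "z \<in> integral_closure R Q"
  proof -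
    obtain p where p: "set p \<subseteq> carrier R" "length p = n" "eval p z = \<ominus> (z [^] n)"
      using powspan_evalE[OF z rsub_neg[OF rsub_powspan[OF z] n]] by blast
    have "polynomial (carrier R) (\<one> # p)" using p(1) nontrivial by (intro polynomialI) auto
    moreover have "eval (\<one> # p) z = \<zero>" using p z by (simp add: r_neg)
    ultimately show ?thesis
      using z unfolding integral_closure_def univ_poly_carrier
      by (intro CollectI conjI bexI[of _ "\<one> # p"]) auto
  qed
qed

text \<open>Once \<open>z^n\<close> lies in the span of the lower powers, that span is closed under
  multiplication by \<open>z\<close>.\<close>

lemma powspan_stable:
  assumes z: "z \<in> carrier Q" and n: "z [^] n \<in> powspan z n"
  shows "z [^] (k::nat) \<in> powspan z n"
proof (cases "k \<le> n")
  case True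
  then show ?thesis using n powspan_mono[OF z, of "Suc k" n] pow_mem_powspan[OF z, of k]
    by (cases "k = n") auto
next
  case False
  have Suc_le: "powspan z (Suc n) \<subseteq> powspan z n"
    unfolding powspan.simps
  proof (rule ssum_least[OF rsub_powspan[OF z]], rule order_refl, rule subsetI)
    fix q assume "q \<in> (z [^] n) \<^bold>* carrier R"
    then obtain r where "r \<in> carrier R" "q = z [^] n \<otimes> r" by (rule scale_memE)
    then show "q \<in> powspan z n" using rsubD(4)[OF rsub_powspan[OF z] _ n, of r] R_sub z by (simp add: m_comm)
  qed
  have "z [^] (n + j) \<in> powspan z n" for j
  proof (induction j)
    case (Suc j)
    then have "z \<otimes> z [^] (n + j) \<in> powspan z n" using mult_powspan[OF z] Suc_le by blast
    then show ?case using z by (simp add: m_comm)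
  qed (use n in simp)
  from this[of "k - n"] False show ?thesis by simp
qed

text \<open>A denominator \<open>s\<close> of \<open>z\<close> has the power \<open>s^n\<close> as a
  common denominator for the span of the first \<open>n\<close> powers of \<open>z\<close>.\<close>

lemma scale_powspan:
  assumes "a \<in> carrier R" "s \<in> carrier R" "z \<in> carrier Q" "s \<otimes> z = a"
  shows "w \<in> powspan z n \<Longrightarrow> s [^] n \<otimes> w \<in> carrier R"
proof (induction n arbitrary: w)
  case (Suc n)
  obtain v r where v: "v \<in> powspan z n" "r \<in> carrier R" "w = v \<oplus> z [^] n \<otimes> r"
    using Suc.prems by (rule powspan_SucE)
  have car: "v \<in> carrier Q" "s \<in> carrier Q" "r \<in> carrier Q" "s [^] n \<in> carrier Q" "z [^] n \<in> carrier Q"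
    using rsubD(1)[OF rsub_powspan] v assms R_sub by auto
  have "(s [^] n \<otimes> z [^] n) = a [^] n" using assms R_sub by (simp add: nat_pow_distrib[symmetric])
  moreover have "s [^] Suc n \<otimes> w = s \<otimes> (s [^] n \<otimes> v) \<oplus> s \<otimes> ((s [^] n \<otimes> z [^] n) \<otimes> r)"
    using car unfolding v(3) nat_pow_Suc by algebra
  ultimately show ?case using Suc.IH[OF v(1)] v(2) assms by (simp add: R_add R_mult R_pow)
qed auto

end

section \<open>Noetherian arguments in the total ring of fractions\<close>

locale fraction_overring = overring +
  assumes fractions: "total_ring_of_fractions R Q"
    and noetherian: "noetherian_ring R"
begin

lemma nonzero_divisors_iff: "d \<in> nonzero_divisors R \<longleftrightarrow> d \<in> carrier R \<and> d \<in> Units Q"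
proof
  assume "d \<in> nonzero_divisors R"
  then show "d \<in> carrier R \<and> d \<in> Units Q"
    using fractions unfolding total_ring_of_fractions_def nonzero_divisors_def by auto
next
  assume d: "d \<in> carrier R \<and> d \<in> Units Q"
  have "b = \<zero>" if "b \<in> carrier R" "d \<otimes> b = \<zero>" for b
  proof -
    have "b = inv d \<otimes> (d \<otimes> b)" using d R_sub[OF that(1)] by (simp add: m_assoc[symmetric] Units_closed)
    then show ?thesis using that d by simp
  qed
  then show "d \<in> nonzero_divisors R" using d unfolding nonzero_divisors_def by auto
qed

lemma fractionE:
  assumes "z \<in> carrier Q"
  obtains a s where "a \<in> carrier R" "s \<in> carrier R" "s \<in> Units Q" "s \<otimes> z = a"
proof -
  obtain a s where a: "a \<in> carrier R" "s \<in> nonzero_divisors R" "z = a \<otimes> inv s"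
    using fractions assms unfolding total_ring_of_fractions_def by blast
  then have s: "s \<in> carrier R" "s \<in> Units Q" using nonzero_divisors_iff by auto
  then have "s \<otimes> z = a" using a R_sub[of a] by (simp add: Units_closed m_lcomm[of s])
  then show ?thesis using a s that by blast
qed

text \<open>The Noetherian condition in the form of Zorn's lemma: a nonempty chain of ideals
  contains its own union.\<close>

lemma maximal_submodule:
  assumes "F \<noteq> {}" "\<And>I. I \<in> F \<Longrightarrow> rsub I \<and> I \<subseteq> carrier R"
  obtains M where "M \<in> F" "\<And>I. I \<in> F \<Longrightarrow> M \<subseteq> I \<Longrightarrow> I = M"
proof -
  have "\<exists>M\<in>F. \<forall>I\<in>F. M \<subseteq> I \<longrightarrow> I = M"
  proof (rule subset_Zorn_nonempty[OF assms(1)])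
    fix C assume C: "C \<noteq> {}" "subset.chain F C"
    then have "subset.chain {I. ideal I R} C"
      using assms(2) unfolding pred_on.chain_def by (auto simp: ideal_iff_rsub)
    then have "\<Union>C \<in> C" by (rule noetherian_ring.ideal_chain_is_trivial[OF noetherian C(1)])
    then show "\<Union>C \<in> F" using C(2) unfolding pred_on.chain_def by auto
  qed
  then show ?thesis using that by blast
qed

lemma ascending_stable:
  assumes "\<And>n::nat. rsub (I n) \<and> I n \<subseteq> carrier R" "\<And>n. I n \<subseteq> I (Suc n)"
  obtains n where "I (Suc n) = I n"
proof -
  obtain M where M: "M \<in> range I" "\<And>J. J \<in> range I \<Longrightarrow> M \<subseteq> J \<Longrightarrow> J = M"
    using maximal_submodule[of "range I"] assms(1) by blast
  then obtain n where "M = I n" by blast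
  then show ?thesis using that[of n] M(2)[of "I (Suc n)"] assms(2)[of n] by simp
qed

text \<open>With a common denominator \<open>d\<close> for all powers of \<open>z\<close>, the
  modules \<open>d * powspan z n\<close> form an ascending chain of ideals of \<open>R\<close>. It
  becomes stationary, and the unit \<open>d\<close> cancels.\<close>

lemma powspan_mem_if_bounded:
  assumes z: "z \<in> carrier Q" and d: "d \<in> carrier R" "d \<in> Units Q"
    and b: "\<And>k. d \<otimes> z [^] (k::nat) \<in> carrier R"
  shows "\<exists>n. z [^] n \<in> powspan z n"
proof -
  let ?I = "\<lambda>n. d \<^bold>* powspan z n"
  have "d \<otimes> w \<in> carrier R" if "w \<in> powspan z n" for w n
    using that
  proof (induction n arbitrary: w)
    case (Suc n)
    obtain v r where v: "v \<in> powspan z n" "r \<in> carrier R" "w = v \<oplus> z [^] n \<otimes> r"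
      using Suc.prems by (rule powspan_SucE)
    have "v \<in> carrier Q" using rsubD(1)[OF rsub_powspan[OF z]] v(1) by blast
    then have "d \<otimes> w = d \<otimes> v \<oplus> (d \<otimes> z [^] n) \<otimes> r"
      using z d R_sub[OF v(2)] R_sub[OF d(1)] unfolding v(3) by (simp add: r_distr m_assoc)
    then show ?case using Suc.IH[OF v(1)] b v(2) by (simp add: R_add R_mult)
  qed (use d R_sub in auto)
  then have "rsub (?I n) \<and> ?I n \<subseteq> carrier R" for n
    using rsub_scale[OF rsub_powspan[OF z], of d n] d R_sub by (auto elim!: scale_memE)
  then obtain n where "?I (Suc n) = ?I n"
    using ascending_stable[of ?I] scale_mono powspan_Suc_ge[OF z] by meson
  then have "inv d \<^bold>* ?I (Suc n) = inv d \<^bold>* ?I n" by simp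
  then have "powspan z (Suc n) = powspan z n"
    using scale_inv(1)[OF d(2)] rsub_powspan[OF z] unfolding rsub_def by metis
  then show ?thesis using pow_mem_powspan[OF z, of n] by auto
qed

text \<open>Over a Noetherian ring, integral and almost integral elements coincide; the latter are
  visibly closed under sums and products.\<close>

lemma integral_closure_iff:
  "z \<in> integral_closure R Q \<longleftrightarrow>
     z \<in> carrier Q \<and> (\<exists>d\<in>carrier R \<inter> Units Q. \<forall>k::nat. d \<otimes> z [^] k \<in> carrier R)"
proof
  assume "z \<in> integral_closure R Q"
  then obtain n where z: "z \<in> carrier Q" and n: "z [^] n \<in> powspan z n"
    unfolding integral_closure_iff_powspan by blast
  obtain a s where s: "a \<in> carrier R" "s \<in> carrier R" "s \<in> Units Q" "s \<otimes> z = a"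
    using z by (rule fractionE)
  have "s [^] n \<otimes> z [^] k \<in> carrier R" for k :: nat
    using scale_powspan[OF s(1,2) z s(4)] powspan_stable[OF z n] by blast
  moreover have "s [^] n \<in> carrier R \<inter> Units Q" using s R_pow by (simp add: Units_pow_closed)
  ultimately show "z \<in> carrier Q \<and> (\<exists>d\<in>carrier R \<inter> Units Q. \<forall>k::nat. d \<otimes> z [^] k \<in> carrier R)"
    using z by blast
qed (use powspan_mem_if_bounded in \<open>auto simp: integral_closure_iff_powspan\<close>)

lemma integral_closureI:
  assumes "z \<in> carrier Q" "d \<in> carrier R" "d \<in> Units Q" "\<And>k. d \<otimes> z [^] (k::nat) \<in> carrier R"
  shows "z \<in> integral_closure R Q"
  using assms unfolding integral_closure_iff by blast

lemma integral_closure_closed: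
  assumes "z \<in> integral_closure R Q" "w \<in> integral_closure R Q"
  shows "z \<oplus> w \<in> integral_closure R Q" "z \<otimes> w \<in> integral_closure R Q"
proof -
  obtain d where z: "z \<in> carrier Q" and d: "d \<in> carrier R" "d \<in> Units Q" "\<And>k::nat. d \<otimes> z [^] k \<in> carrier R"
    using assms(1) unfolding integral_closure_iff by blast
  obtain e where w: "w \<in> carrier Q" and e: "e \<in> carrier R" "e \<in> Units Q" "\<And>k::nat. e \<otimes> w [^] k \<in> carrier R"
    using assms(2) unfolding integral_closure_iff by blast
  have dQ: "d \<in> carrier Q" and eQ: "e \<in> carrier Q" using d e R_sub by auto
  \<comment> \<open>\<open>M\<close> consists of the elements for which \<open>d e\<close> clears
    denominators even after multiplication by any monomial in \<open>z\<close> and \<open>w\<close>.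
    It contains 1 and is closed under addition and under multiplication by \<open>z\<close> and
    \<open>w\<close>.\<close>
  define M where "M = {q \<in> carrier Q. \<forall>(i::nat) (j::nat). d \<otimes> e \<otimes> q \<otimes> (z [^] i \<otimes> w [^] j) \<in> carrier R}"
  have M1: "\<one> \<in> M"
  proof -
    have "d \<otimes> e \<otimes> \<one> \<otimes> (z [^] i \<otimes> w [^] j) = (d \<otimes> z [^] i) \<otimes> (e \<otimes> w [^] j)" for i j :: nat
      using z w dQ eQ by (simp add: m_ac)
    then show ?thesis unfolding M_def using d(3) e(3) R_mult by auto
  qed
  have Mz: "z \<otimes> q \<in> M" if "q \<in> M" for q
  proof -
    have q: "q \<in> carrier Q" "d \<otimes> e \<otimes> q \<otimes> (z [^] Suc i \<otimes> w [^] j) \<in> carrier R" for i j :: nat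
      using that unfolding M_def by blast+
    have "d \<otimes> e \<otimes> (z \<otimes> q) \<otimes> (z [^] i \<otimes> w [^] j) = d \<otimes> e \<otimes> q \<otimes> (z [^] Suc i \<otimes> w [^] j)" for i j :: nat
      using z w dQ eQ q(1) by (simp add: m_ac)
    then show ?thesis unfolding M_def using q z by auto
  qed
  have Mw: "w \<otimes> q \<in> M" if "q \<in> M" for q
  proof -
    have q: "q \<in> carrier Q" "d \<otimes> e \<otimes> q \<otimes> (z [^] i \<otimes> w [^] Suc j) \<in> carrier R" for i j :: nat
      using that unfolding M_def by blast+
    have "d \<otimes> e \<otimes> (w \<otimes> q) \<otimes> (z [^] i \<otimes> w [^] j) = d \<otimes> e \<otimes> q \<otimes> (z [^] i \<otimes> w [^] Suc j)" for i j :: nat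
      using z w dQ eQ q(1) by (simp add: m_ac)
    then show ?thesis unfolding M_def using q w by auto
  qed
  have Madd: "p \<oplus> q \<in> M" if "p \<in> M" "q \<in> M" for p q
  proof -
    have pq: "p \<in> carrier Q" "q \<in> carrier Q" using that unfolding M_def by auto
    have "d \<otimes> e \<otimes> (p \<oplus> q) \<otimes> (z [^] i \<otimes> w [^] j) =
        d \<otimes> e \<otimes> p \<otimes> (z [^] i \<otimes> w [^] j) \<oplus> d \<otimes> e \<otimes> q \<otimes> (z [^] i \<otimes> w [^] j)" for i j :: nat
      using z w dQ eQ pq by (simp add: l_distr r_distr)
    then show ?thesis using that R_add unfolding M_def by auto
  qed
  \<comment> \<open>If \<open>u M \<subseteq> M\<close>, then every power of \<open>u\<close> lies
    in \<open>M\<close>; the monomial with both exponents 0 shows that \<open>d e\<close> is a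
    common denominator for these powers.\<close>
  have *: "u \<in> integral_closure R Q" if u: "u \<in> carrier Q" "\<And>q. q \<in> M \<Longrightarrow> u \<otimes> q \<in> M" for u
  proof (rule integral_closureI[OF u(1), of "d \<otimes> e"])
    fix k :: nat
    have "u [^] k \<in> M"
    proof (induction k)
      case (Suc k)
      then show ?case using u(2)[of "u [^] k"] u(1) by (simp add: m_comm)
    qed (use M1 in simp)
    then have "d \<otimes> e \<otimes> u [^] k \<otimes> (z [^] (0::nat) \<otimes> w [^] (0::nat)) \<in> carrier R"
      unfolding M_def by fast
    then show "d \<otimes> e \<otimes> u [^] k \<in> carrier R" using u(1) dQ eQ by simp
  qed (use d e R_mult in auto)
  have MQ: "q \<in> carrier Q" if "q \<in> M" for q using that unfolding M_def by blast
  show "z \<oplus> w \<in> integral_closure R Q"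
    using z w Mz Mw Madd MQ by (intro *) (auto simp: l_distr)
  show "z \<otimes> w \<in> integral_closure R Q"
    using z w Mz Mw MQ by (intro *) (auto simp: m_assoc)
qed

abbreviation Rbar where "Rbar \<equiv> integral_closure R Q"

lemma R_subset_Rbar: "carrier R \<subseteq> Rbar"
  using R_sub R_pow by (auto intro!: integral_closureI[of _ \<one>])

lemma rsub_Rbar: "rsub Rbar"
proof (rule rsubI)
  show "Rbar \<subseteq> carrier Q" unfolding integral_closure_def by blast
qed (use R_subset_Rbar R_zero integral_closure_closed in blast)+

end

section \<open>Reductions and the conductor\<close>

lemma ideals_set_simps [simp]:
  "\<one>\<^bsub>ideals_set R\<^esub> = carrier R" "monoid.mult (ideals_set R) = ideal_prod R"
  by (simp_all add: ideals_set_def)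

lemma (in cring) ideal_ideal_power: "ideal I R \<Longrightarrow> ideal (ideal_power R I n) R"
  by (induction n) (auto simp: oneideal ideal_prod_is_ideal)

text \<open>Positive depth yields a nonempty regular sequence in \<open>m\<close>. Its first member
  is regular modulo the ideal generated by the empty set, which is zero.\<close>

lemma (in cring) nonzero_divisor_if_depth:
  assumes "1 \<le> depth R m"
  shows "\<exists>d\<in>m. d \<in> nonzero_divisors R"
proof -
  have "\<exists>xs. regular_sequence R xs \<and> set xs \<subseteq> m \<and> xs \<noteq> []"
  proof (rule ccontr)
    assume "\<not> ?thesis"
    then have "depth R m \<le> 0" unfolding depth_def by (intro Sup_least) (auto simp: zero_enat_def)
    then show False using assms by (metis le_zero_eq not_one_le_zero)
  qed
  then obtain d xs where xs: "regular_sequence R (d # xs)" "set (d # xs) \<subseteq> m" by (metis list.exhaust)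
  have "Idl {} \<subseteq> {\<zero>}" by (rule genideal_minimal[OF zeroideal]) simp
  moreover have "\<zero> \<in> Idl {}"
    using genideal_ideal[of "{}"] ideal.axioms(1) additive_subgroup.zero_closed by blast
  ultimately have "Idl {} = {\<zero>}" by blast
  then have "d \<in> nonzero_divisors R"
    using xs(1) unfolding regular_sequence_def nonzero_divisors_def by (auto dest: spec[of _ 0])
  then show ?thesis using xs by auto
qed

text \<open>For a reduction \<open>(x)\<close> of \<open>m\<close> with exponent \<open>n\<close>,
  the power \<open>d^(n+1)\<close> lies in \<open>x m^n\<close>, so \<open>x\<close> divides a unit
  of \<open>Q\<close>.\<close>

lemma (in fraction_overring) unit_if_reduction:
  assumes m: "ideal m R" and d: "d \<in> m" "d \<in> Units Q" and x: "x \<in> m"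
    and red: "reduction R m (PIdl\<^bsub>R\<^esub> x)"
  shows "x \<in> Units Q"
proof -
  interpret R: cring R by (rule cring_R)
  have xR: "x \<in> carrier R" and dR: "d \<in> carrier R" using m d x ideal_iff_rsub by auto
  obtain n where n: "(PIdl\<^bsub>R\<^esub> x) \<cdot>\<^bsub>R\<^esub> ideal_power R m n = ideal_power R m (Suc n)"
    using red unfolding reduction_def by blast
  have "d [^] k \<in> ideal_power R m k" for k :: nat
  proof (induction k)
    case (Suc k)
    then show ?case using ideal_prod.prod[OF Suc d(1), of R] by simp
  qed simp
  then have "d [^] Suc n \<in> (PIdl\<^bsub>R\<^esub> x) \<cdot>\<^bsub>R\<^esub> ideal_power R m n" unfolding n by blast
  also have "\<dots> \<subseteq> PIdl\<^bsub>R\<^esub> x"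
    using R.ideal_prod_inter[OF R.cgenideal_ideal[OF xR] R.ideal_ideal_power[OF m]] by blast
  finally obtain r where r: "r \<in> carrier R" "d [^] Suc n = r \<otimes> x" unfolding cgenideal_def by auto
  have "d [^] Suc n \<in> Units Q" using d(2) Units_pow_closed by blast
  then show ?thesis using r R_sub xR by (metis unit_factor m_comm)
qed

section \<open>The local ring and a principal reduction of its maximal ideal\<close>

locale local_fraction_overring = fraction_overring +
  fixes m x
  assumes local: "local_ring R m"
    and x: "x \<in> m" "x \<in> Units Q"
    and reduction: "reduction R m (PIdl\<^bsub>R\<^esub> x)"
begin

lemma m_ideal: "ideal m R" and m_proper: "m \<noteq> carrier R"
  using local unfolding local_ring_def maximalideal_def maximalideal_axioms_def by auto

lemma rsub_m: "rsub m" and m_subset: "m \<subseteq> carrier R"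
  using m_ideal ideal_iff_rsub by auto

lemma one_not_mem_m: "\<one> \<notin> m"
proof
  assume "\<one> \<in> m"
  then have "r \<in> m" if "r \<in> carrier R" for r using rsubD(4)[OF rsub_m that] R_sub[OF that] by fastforce
  then show False using m_proper m_subset by blast
qed

lemma xR: "x \<in> carrier R" and xQ: "x \<in> carrier Q"
  using x m_subset R_sub by auto

text \<open>Otherwise some ideal is maximal among those containing \<open>r\<close> but not 1. It is
  a maximal ideal, hence equal to \<open>m\<close>, and \<open>r\<close> would lie in
  \<open>m\<close>.\<close>

lemma unit_if_not_mem_m:
  assumes "r \<in> carrier R" "r \<notin> m"
  obtains s where "s \<in> carrier R" "r \<otimes> s = \<one>"
proof -
  have rQ: "r \<in> carrier Q" using assms R_sub by auto
  have "\<one> \<in> r \<^bold>* carrier R"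
  proof (rule ccontr)
    assume "\<one> \<notin> r \<^bold>* carrier R"
    let ?F = "{I. rsub I \<and> I \<subseteq> carrier R \<and> r \<in> I \<and> \<one> \<notin> I}"
    have "r \<^bold>* carrier R \<subseteq> carrier R" using assms(1) R_mult by (auto elim!: scale_memE)
    then have "r \<^bold>* carrier R \<in> ?F"
      using \<open>\<one> \<notin> _\<close> rsub_scale[OF rsub_R rQ] scale_mem[of \<one> "carrier R" r] rQ by simp
    then obtain M where M: "M \<in> ?F" "\<And>I. I \<in> ?F \<Longrightarrow> M \<subseteq> I \<Longrightarrow> I = M"
      using maximal_submodule[of ?F] by blast
    have "maximalideal M R"
    proof (rule maximalidealI)
      show "ideal M R" using M(1) ideal_iff_rsub by auto
      show "carrier R \<noteq> M" using M(1) R_one by blast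
      fix J assume J: "ideal J R" "M \<subseteq> J" "J \<subseteq> carrier R"
      have "rsub J" using J ideal_iff_rsub by auto
      show "J = M \<or> J = carrier R"
      proof (cases "\<one> \<in> J")
        case True
        then have "s \<in> J" if "s \<in> carrier R" for s
          using rsubD(4)[OF \<open>rsub J\<close> that True] R_sub[OF that] by simp
        then show ?thesis using J by blast
      next
        case False
        then show ?thesis using M(2)[of J] J M(1) \<open>rsub J\<close> by blast
      qed
    qed
    then have "M = m" using local unfolding local_ring_def by blast
    then show False using M(1) assms(2) by blast
  qed
  then show ?thesis using that by (auto elim!: scale_memE)
qed

lemma one_minus_m_unit:
  assumes "a \<in> m"
  obtains s where "s \<in> carrier R" "(\<one> \<ominus> a) \<otimes> s = \<one>"
proof -
  have a: "a \<in> carrier R" "a \<in> carrier Q" using assms m_subset R_sub by auto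
  have "\<one> \<ominus> a \<notin> m"
  proof
    assume "\<one> \<ominus> a \<in> m"
    then have "(\<one> \<ominus> a) \<oplus> a \<in> m" using assms rsubD(3)[OF rsub_m] by blast
    moreover have "(\<one> \<ominus> a) \<oplus> a = \<one>" using a by algebra
    ultimately show False using one_not_mem_m by simp
  qed
  moreover have "\<one> \<ominus> a \<in> carrier R" using R_minus[OF R_one a(1)] .
  ultimately show ?thesis using unit_if_not_mem_m that by metis
qed

lemma ideal_power_nzd: "ideal_power R m n \<subseteq> carrier R" "x [^] n \<in> ideal_power R m n"
proof -
  interpret R: cring R by (rule cring_R)
  show "ideal_power R m n \<subseteq> carrier R"
    using R.ideal_ideal_power[OF m_ideal, of n] ideal_iff_rsub by blast
  show "x [^] n \<in> ideal_power R m n"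
  proof (induction n)
    case (Suc n)
    then show ?case using ideal_prod.prod[of "x [^] n" _ x m R] x by simp
  qed simp
qed

text \<open>From \<open>b m^n \<subseteq> m^(n+1) = x m^n\<close>, multiplication by
  \<open>b / x\<close> maps \<open>m^n\<close> into itself. As \<open>x^n \<in> m^n\<close>, the
  element \<open>x^n\<close> is a common denominator for all powers of \<open>b / x\<close>.\<close>

lemma m_div_x_integral:
  assumes b: "b \<in> m" shows "inv x \<otimes> b \<in> Rbar"
proof -
  interpret R: cring R by (rule cring_R)
  obtain n where n: "(PIdl\<^bsub>R\<^esub> x) \<cdot>\<^bsub>R\<^esub> ideal_power R m n = ideal_power R m (Suc n)"
    using reduction unfolding reduction_def by blast
  let ?P = "ideal_power R m n" and ?z = "inv x \<otimes> b"
  have P: "rsub ?P" using R.ideal_ideal_power[OF m_ideal, of n] ideal_iff_rsub by blast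
  have bQ: "b \<in> carrier Q" using b rsubD(1)[OF rsub_m] by blast
  have z: "?z \<in> carrier Q" using bQ x by simp
  have *: "p \<in> x \<^bold>* ?P" if "p \<in> (PIdl\<^bsub>R\<^esub> x) \<cdot>\<^bsub>R\<^esub> ?P" for p
    using that
  proof (induction rule: ideal_prod.induct)
    case (prod i j)
    then obtain r where r: "r \<in> carrier R" "i = r \<otimes> x" unfolding cgenideal_def by auto
    have "j \<in> carrier Q" "r \<in> carrier Q" using prod rsubD(1)[OF P] R_sub r by auto
    then have "i \<otimes> j = x \<otimes> (r \<otimes> j)" using xQ r by (simp add: m_ac)
    then show ?case using scale_mem[OF rsubD(4)[OF P r(1) prod(2)], of x] by simp
  next
    case (sum s1 s2)
    then show ?case using rsubD(3)[OF rsub_scale[OF P xQ]] by simp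
  qed
  have "?z \<otimes> q \<in> ?P" if q: "q \<in> ?P" for q
  proof -
    have "q \<otimes>\<^bsub>R\<^esub> b \<in> ideal_power R m (Suc n)"
      using ideal_prod.prod[OF q b, of R] by simp
    then have "q \<otimes> b \<in> x \<^bold>* ?P" using * unfolding n by simp
    then obtain p where p: "p \<in> ?P" "q \<otimes> b = x \<otimes> p" by (rule scale_memE)
    have "q \<in> carrier Q" "p \<in> carrier Q" using p(1) q rsubD(1)[OF P] by auto
    then have "?z \<otimes> q = inv x \<otimes> (x \<otimes> p)" using x bQ p(2)[symmetric] by (simp add: m_ac)
    also have "\<dots> = p" using \<open>p \<in> carrier Q\<close> x xQ by (simp add: m_assoc[symmetric])
    finally show ?thesis using p by simp
  qed
  then have *: "x [^] n \<otimes> ?z [^] k \<in> ?P" for k :: nat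
  proof (induction k)
    case 0
    then show ?case using ideal_power_nzd(2)[of n] xQ by simp
  next
    case (Suc k)
    then have "?z \<otimes> (x [^] n \<otimes> ?z [^] k) \<in> ?P" by blast
    moreover have "?z \<otimes> (x [^] n \<otimes> ?z [^] k) = x [^] n \<otimes> ?z [^] Suc k"
      unfolding nat_pow_Suc using z nat_pow_closed[OF z, of k] nat_pow_closed[OF xQ, of n]
      by (metis m_assoc m_comm m_closed)
    ultimately show ?case by simp
  qed
  have "x [^] n \<otimes> ?z [^] k \<in> carrier R" for k :: nat
    using ideal_power_nzd(1)[of n] *[of k] by blast
  then show ?thesis using z x xR by (intro integral_closureI[of _ "x [^] n"]) (auto simp: R_pow Units_pow_closed)
qed

text \<open>If no power of \<open>x\<close> lay in \<open>I\<close>, the ideals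
  \<open>I + x^n R\<close> would descend strictly, giving chains of every length above
  \<open>I\<close>.\<close>

lemma pow_mem_if_finite_colength:
  assumes I: "rsub I" "I \<subseteq> carrier R" and fin: "len I (carrier R) \<noteq> \<infinity>"
  shows "\<exists>n. x [^] (n::nat) \<in> I"
proof (rule ccontr)
  assume "\<not> ?thesis"
  then have notin: "x [^] n \<notin> I" for n :: nat by blast
  define J where "J n = I \<^bold>+ (x [^] n) \<^bold>* carrier R" for n :: nat
  have J: "rsub (J n)" "I \<subseteq> J n" "(x [^] n) \<^bold>* carrier R \<subseteq> J n" for n
    unfolding J_def using I rsub_ssum ssum_ge1 ssum_ge2 rsub_scale[OF rsub_R] xQ by auto
  have JR: "J n \<subseteq> carrier R" for n
    unfolding J_def using I R_mult R_pow[OF xR] by (intro ssum_least rsub_R) (auto elim!: scale_memE)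
  have strict: "J (Suc n) \<subset> J n" for n
  proof
    show "J (Suc n) \<subseteq> J n"
      unfolding J_def[of "Suc n"]
    proof (rule ssum_least[OF J(1) J(2)], rule subsetI)
      fix q assume "q \<in> (x [^] Suc n) \<^bold>* carrier R"
      then obtain r where r: "r \<in> carrier R" "q = x [^] n \<otimes> (x \<otimes> r)"
        using xQ R_sub by (auto elim!: scale_memE simp: m_assoc)
      then show "q \<in> J n" using J(3)[of n] scale_mem[of "x \<otimes> r" "carrier R"] R_mult[OF xR r(1)] by blast
    qed
    show "J (Suc n) \<noteq> J n"
    proof
      assume "J (Suc n) = J n"
      moreover have "x [^] n \<in> J n" using J(3)[of n] scale_mem[of \<one> "carrier R" "x [^] n"] xQ by auto
      ultimately have "x [^] n \<in> J (Suc n)" by simp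
      then obtain i r where ir: "i \<in> I" "r \<in> carrier R" "x [^] n = i \<oplus> x [^] Suc n \<otimes> r"
        unfolding J_def by (auto elim!: ssum_memE scale_memE)
      have iQ: "i \<in> carrier Q" "r \<in> carrier Q" "x [^] n \<in> carrier Q" using ir I(2) R_sub xQ by auto
      \<comment> \<open>Nakayama's argument: \<open>x^n = i + x^(n+1) r\<close> gives
        \<open>x^n (1 - x r) = i \<in> I\<close>, and \<open>1 - x r\<close> is a unit of
        \<open>R\<close>.\<close>
      have "x \<otimes> r \<in> m" using rsubD(4)[OF rsub_m ir(2) x(1)] iQ xQ by (simp add: m_comm)
      then obtain s where s: "s \<in> carrier R" "(\<one> \<ominus> x \<otimes> r) \<otimes> s = \<one>" by (rule one_minus_m_unit)
      define p where "p = x [^] n"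
      have pQ: "p \<in> carrier Q" using iQ unfolding p_def by simp
      have p: "p = i \<oplus> p \<otimes> x \<otimes> r" using ir(3) unfolding p_def by simp
      have "p \<otimes> (\<one> \<ominus> x \<otimes> r) = p \<ominus> p \<otimes> x \<otimes> r" using iQ xQ pQ by algebra
      also have "\<dots> = (i \<oplus> p \<otimes> x \<otimes> r) \<ominus> p \<otimes> x \<otimes> r" using p by simp
      also have "\<dots> = i" using iQ xQ pQ by algebra
      finally have "x [^] n \<otimes> (\<one> \<ominus> x \<otimes> r) = i" unfolding p_def .
      then have "i \<otimes> s = x [^] n \<otimes> ((\<one> \<ominus> x \<otimes> r) \<otimes> s)"
        using iQ xQ R_sub[OF s(1)] by (simp add: m_assoc[symmetric])
      then have "i \<otimes> s = x [^] n" using s iQ by simp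
      then show False using notin[of n] rsubD(4)[OF I(1) s(1) ir(1)] iQ R_sub[OF s(1)] by (simp add: m_comm)
    qed
  qed
  have "enat n \<le> len (J n) (carrier R)" for n
  proof (induction n)
    case (Suc n)
    have "enat (Suc n) = 1 + enat n" by (simp add: one_enat_def)
    also have "\<dots> \<le> len (J (Suc n)) (J n) + len (J n) (carrier R)"
      using Suc strict J by (intro add_mono len_ge_1) auto
    also have "\<dots> = len (J (Suc n)) (carrier R)"
      using strict[of n] J JR rsub_R by (intro len_add[symmetric]) auto
    finally show ?case .
  qed (simp add: zero_enat_def[symmetric])
  then have "enat n \<le> len I (carrier R)" for n
    using len_mono[OF J(2)[of n] order_refl] order_trans by blast
  then show False using fin by (metis enat_ile enat_ord_simps(1) Suc_n_not_le_n not_infinity_eq)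
qed

section \<open>The conductor and finiteness of the integral closure\<close>

abbreviation c where "c \<equiv> conductor R Q"

lemma rsub_c: "rsub c"
  unfolding conductor_def using rsubD(1)[OF rsub_Rbar] by (intro rsub_colon rsub_R) auto

lemma c_subset: "c \<subseteq> carrier R"
proof
  fix q assume "q \<in> c"
  then have "q \<otimes> \<one> \<in> carrier R" "q \<in> carrier Q"
    using R_subset_Rbar R_one unfolding conductor_def colon_def by blast+
  then show "q \<in> carrier R" by simp
qed

lemma c_mult: 
  assumes "q \<in> c" "v \<in> Rbar" shows "q \<otimes> v \<in> c"
proof -
  have q: "q \<in> carrier Q" "\<And>w. w \<in> Rbar \<Longrightarrow> q \<otimes> w \<in> carrier R"
    using assms(1) unfolding conductor_def colon_def by auto
  have "q \<otimes> v \<otimes> w \<in> carrier R" if "w \<in> Rbar" for w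
    using q(2)[OF integral_closure_closed(2)[OF assms(2) that]] q(1) that assms(2) rsubD(1)[OF rsub_Rbar]
    by (simp add: m_assoc)
  then show ?thesis using q assms(2) rsubD(1)[OF rsub_Rbar] unfolding conductor_def colon_def by auto
qed

text \<open>For \<open>x^n\<close> in the conductor, \<open>x^n Rbar\<close> is an ideal of
  \<open>R\<close>, hence finitely generated. Dividing its generators by \<open>x^n\<close> gives
  finitely many generators of \<open>Rbar\<close>, each multiplied into \<open>R\<close> by the
  conductor.\<close>

lemma finite_len_Rbar:
  assumes fin: "len c (carrier R) \<noteq> \<infinity>"
  shows "len (carrier R) Rbar \<noteq> \<infinity>"
proof -
  interpret R: cring R by (rule cring_R)
  obtain n where n: "x [^] (n::nat) \<in> c" using pow_mem_if_finite_colength[OF rsub_c c_subset fin] by blast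
  let ?u = "x [^] n"
  have u: "?u \<in> Units Q" using x Units_pow_closed by blast
  have uV: "?u \<^bold>* Rbar \<subseteq> carrier R" using c_mult[OF n] c_subset by (auto elim!: scale_memE)
  then have "ideal (?u \<^bold>* Rbar) R"
    using rsub_scale[OF rsub_Rbar] Units_closed[OF u] ideal_iff_rsub by blast
  then obtain S where S: "S \<subseteq> carrier R" "finite S" "?u \<^bold>* Rbar = Idl\<^bsub>R\<^esub> S"
    using noetherian_ring.finetely_gen[OF noetherian] by blast
  have SV: "inv ?u \<otimes> s \<in> Rbar" if "s \<in> S" for s
  proof -
    have "s \<in> ?u \<^bold>* Rbar" using R.genideal_self[OF S(1)] that S(3) by blast
    then show ?thesis using scale_inv(1)[OF u, of Rbar] rsubD(1)[OF rsub_Rbar] scale_mem[of s _ "inv ?u"] by blast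
  qed
  let ?G = "(\<lambda>s. inv ?u \<otimes> s) ` S"
  have "a \<otimes> g \<in> carrier R" if "g \<in> ?G" "a \<in> c" for g a
    using that c_mult SV c_subset by blast
  then have "\<exists>B. rsub B \<and> carrier R \<subseteq> B \<and> ?G \<subseteq> B \<and>
      len (carrier R) B \<le> of_nat (card ?G) * len c (carrier R)"
    using S SV rsubD(1)[OF rsub_Rbar] c_subset by (intro adjoin_generators rsub_R) auto
  then obtain B where B: "rsub B" "carrier R \<subseteq> B" "?G \<subseteq> B"
    "len (carrier R) B \<le> of_nat (card ?G) * len c (carrier R)" by blast
  \<comment> \<open>The ideal of all \<open>r\<close> with \<open>r / x^n \<in> B\<close> contains
    \<open>S\<close> and hence \<open>x^n Rbar\<close>, so
    \<open>Rbar \<subseteq> B\<close>.\<close>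
  let ?J = "{r \<in> carrier R. inv ?u \<otimes> r \<in> B}"
  have "ideal ?J R" unfolding ideal_iff_rsub using rsub_colon_elem[OF B(1) rsub_R, of "inv ?u"] u by auto
  then have "Idl\<^bsub>R\<^esub> S \<subseteq> ?J" using S B(3) by (intro R.genideal_minimal) auto
  then have "inv ?u \<^bold>* ?u \<^bold>* Rbar \<subseteq> B" using S(3) by (auto elim!: scale_memE[of _ "inv ?u"])
  then have "Rbar \<subseteq> B" using scale_inv(1)[OF u, of Rbar] rsubD(1)[OF rsub_Rbar] by auto
  then have "len (carrier R) Rbar \<le> of_nat (card ?G) * len c (carrier R)"
    using len_mono[of "carrier R" "carrier R" Rbar B] B(4) by (meson order_refl order_trans)
  moreover have "of_nat (card ?G) * len c (carrier R) \<noteq> \<infinity>"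
    using fin by (auto simp: of_nat_eq_enat)
  ultimately show ?thesis by (metis enat_ord_simps(5))
qed

end

section \<open>The conductor is principal over the integral closure\<close>

context overring
begin

declare powspan.simps(2) [simp del]

lemma eval_mem_R: "set p \<subseteq> carrier R \<Longrightarrow> b \<in> carrier R \<Longrightarrow> eval p b \<in> carrier R"
  by (induction p) (auto intro!: R_add R_mult R_pow)

lemma R_subset_powspan: "z \<in> carrier Q \<Longrightarrow> carrier R \<subseteq> powspan z (Suc n)"
proof
  fix r assume z: "z \<in> carrier Q" and r: "r \<in> carrier R"
  have "\<zero> \<oplus> z [^] (0::nat) \<otimes> r \<in> powspan z (Suc 0)" using r by (intro powspan_SucI) auto
  then have "r \<in> powspan z (Suc 0)" using R_sub[OF r] by simp
  then show "r \<in> powspan z (Suc n)" using powspan_mono[OF z, of "Suc 0" "Suc n"] by auto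
qed

text \<open>First-order Taylor expansion at \<open>b\<close>; the cofactor of \<open>u - b\<close>
  is recorded as a combination of the first \<open>n\<close> powers of \<open>u - b\<close>.\<close>

lemma pow_shift:
  assumes u: "u \<in> carrier Q" and b: "b \<in> carrier R"
  shows "\<exists>w\<in>powspan (u \<ominus> b) n. u [^] n = b [^] n \<oplus> (u \<ominus> b) \<otimes> w"
proof (induction n)
  case 0
  then show ?case using u b R_sub by auto
next
  case (Suc n)
  let ?v = "u \<ominus> b"
  have v: "?v \<in> carrier Q" and bQ: "b \<in> carrier Q" using u b R_sub by auto
  obtain w where w: "w \<in> powspan ?v n" "u [^] n = b [^] n \<oplus> ?v \<otimes> w" using Suc by blast
  note P = rsubD[OF rsub_powspan[OF v]]
  have wQ: "w \<in> carrier Q" using P(1) w(1) .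
  define p where "p = b [^] n"
  have p: "p \<in> carrier R" "p \<in> carrier Q" unfolding p_def using b bQ R_pow by auto
  \<comment> \<open>With \<open>v = u - b\<close> and \<open>p = b^n\<close>, this comes from
    \<open>(p + v w)(v + b) = p b + v (p + v w + b w)\<close>.\<close>
  let ?w = "p \<oplus> ?v \<otimes> w \<oplus> b \<otimes> w"
  have "?w \<in> powspan ?v (Suc n)"
  proof (intro P(3))
    show "p \<in> powspan ?v (Suc n)" using p R_subset_powspan[OF v] by blast
    show "?v \<otimes> w \<in> powspan ?v (Suc n)" using mult_powspan[OF v w(1)] .
    show "b \<otimes> w \<in> powspan ?v (Suc n)" using P(4)[OF b w(1)] powspan_Suc_ge[OF v] by blast
  qed
  moreover have "(p \<oplus> ?v \<otimes> w) \<otimes> u = p \<otimes> b \<oplus> ?v \<otimes> ?w" using p u bQ wQ by algebra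
  ultimately show ?case using w(2) unfolding p_def by auto
qed

lemma eval_shift:
  assumes u: "u \<in> carrier Q" and b: "b \<in> carrier R"
  shows "set p \<subseteq> carrier R \<Longrightarrow>
    \<exists>w\<in>powspan (u \<ominus> b) (length p). eval p u = eval p b \<oplus> (u \<ominus> b) \<otimes> w"
proof (induction p)
  case Nil
  then show ?case using u b R_sub by auto
next
  case (Cons a p)
  let ?v = "u \<ominus> b" and ?n = "length p"
  have v: "?v \<in> carrier Q" and bQ: "b \<in> carrier Q" and aQ: "a \<in> carrier Q" 
    and a: "a \<in> carrier R" using u b Cons.prems R_sub by auto
  note P = rsubD[OF rsub_powspan[OF v]]
  obtain w where w: "w \<in> powspan ?v ?n" "u [^] ?n = b [^] ?n \<oplus> ?v \<otimes> w" using pow_shift[OF u b] by blast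
  obtain w' where w': "w' \<in> powspan ?v ?n" "eval p u = eval p b \<oplus> ?v \<otimes> w'" using Cons by auto
  have pQ: "set p \<subseteq> carrier Q" using Cons.prems R_sub by auto
  have wQ: "w \<in> carrier Q" "w' \<in> carrier Q" using P(1) w(1) w'(1) by auto
  have "a \<otimes> w \<oplus> w' \<in> powspan ?v (Suc ?n)"
    using a w(1) w'(1) powspan_Suc_ge[OF v, of ?n] by (intro P(3,4)) auto
  moreover have "a \<otimes> (b [^] ?n \<oplus> ?v \<otimes> w) \<oplus> (eval p b \<oplus> ?v \<otimes> w') =
      (a \<otimes> b [^] ?n \<oplus> eval p b) \<oplus> ?v \<otimes> (a \<otimes> w \<oplus> w')"
    using aQ bQ v wQ eval_in_carrier[OF pQ bQ] by (simp add: r_distr a_ac m_ac)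
  ultimately show ?case using w(2) w'(2) by auto
qed

text \<open>Multiplication by \<open>t^n\<close> reverses exponents:
  \<open>t^n v^j = t^(n-j)\<close> for \<open>j < n\<close>, with exponents from 1 to
  \<open>n\<close>.\<close>

lemma pow_inverse_powspan:
  assumes v: "v \<in> carrier Q" and t: "t \<in> carrier Q" "v \<otimes> t = \<one>"
  shows "w \<in> powspan v n \<Longrightarrow> t [^] n \<otimes> w \<in> powspan t (Suc n)"
proof (induction n arbitrary: w)
  case 0
  then show ?case using rsubD(2)[OF rsub_powspan[OF t(1)], of "Suc 0"] by auto
next
  case (Suc n)
  obtain w' r where w: "w' \<in> powspan v n" "r \<in> carrier R" "w = w' \<oplus> v [^] n \<otimes> r"
    using Suc.prems by (rule powspan_SucE)
  have car: "w' \<in> carrier Q" "r \<in> carrier Q" "t [^] n \<in> carrier Q" "v [^] n \<in> carrier Q"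
    using rsubD(1)[OF rsub_powspan[OF v]] w R_sub t v by auto
  have "t [^] n \<otimes> v [^] n = \<one>" using t v by (simp add: nat_pow_distrib[symmetric] m_comm)
  then have "t \<otimes> r = t \<otimes> (t [^] n \<otimes> v [^] n) \<otimes> r" using t car by simp
  then have "t [^] Suc n \<otimes> w = t \<otimes> (t [^] n \<otimes> w') \<oplus> t \<otimes> r"
    using car t unfolding w(3) by (simp add: r_distr m_ac)
  moreover have "t \<otimes> (t [^] n \<otimes> w') \<in> powspan t (Suc (Suc n))"
    using mult_powspan[OF t(1) Suc.IH[OF w(1)]] .
  moreover have "t \<otimes> r \<in> powspan t (Suc (Suc n))"
    using mult_powspan[OF t(1), of r "Suc n"] R_subset_powspan[OF t(1), of n] w(2) by blast
  ultimately show ?case using rsubD(3)[OF rsub_powspan[OF t(1)]] by simp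
qed

text \<open>With \<open>s\<close> a unit of \<open>R\<close>, the relation says that
  \<open>t = 1 / v\<close> equals \<open>- w / s\<close>, a polynomial in \<open>v\<close> of degree
  below \<open>n\<close>. Multiplying \<open>t\<close> by \<open>t^n\<close> turns this into a monic
  equation of degree \<open>n + 1\<close> for \<open>t\<close>.\<close>

lemma inverse_integral:
  assumes v: "v \<in> carrier Q" and w: "w \<in> powspan v n"
    and s: "s \<in> carrier R" "s' \<in> carrier R" "s \<otimes> s' = \<one>" "s \<oplus> v \<otimes> w = \<zero>"
  shows "v \<in> Units Q" "inv v \<in> integral_closure R Q"
proof -
  note P = rsubD[OF rsub_powspan[OF v]]
  have wQ: "w \<in> carrier Q" "s \<in> carrier Q" "s' \<in> carrier Q" using P(1) w s R_sub by auto
  let ?t = "\<ominus> s' \<otimes> w"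
  have "v \<otimes> ?t = \<ominus> (s' \<otimes> (s \<oplus> v \<otimes> w)) \<oplus> s \<otimes> s'" using v wQ by algebra
  then have vt: "v \<otimes> ?t = \<one>" using s(3,4) wQ v by simp
  have tQ: "?t \<in> carrier Q" using wQ by simp
  show u: "v \<in> Units Q" using vt v tQ m_comm[OF v tQ] unfolding Units_def by auto
  have "inv v = ?t" using vt v tQ comm_inv_char by simp
  moreover have "?t \<in> powspan v n" using P(4)[OF R_neg[OF s(2)] w] .
  then have "?t [^] n \<otimes> ?t \<in> powspan ?t (Suc n)" by (rule pow_inverse_powspan[OF v tQ vt])
  then have "?t [^] Suc n \<in> powspan ?t (Suc n)" by simp
  then have "?t \<in> integral_closure R Q" unfolding integral_closure_iff_powspan using tQ by blast
  ultimately show "inv v \<in> integral_closure R Q" by simp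
qed

text \<open>Each factor of the filtration
  \<open>M \<supseteq> uM \<supseteq> u^2 M \<supseteq> ...\<close> is isomorphic to
  \<open>M / uM\<close>.\<close>

lemma len_scale_pow:
  assumes u: "u \<in> Units Q" and M: "rsub M" "u \<^bold>* M \<subseteq> M"
  shows "len ((u [^] (k::nat)) \<^bold>* M) M = of_nat k * len (u \<^bold>* M) M"
proof (induction k)
  case 0
  have "\<one> \<^bold>* M = M" unfolding scale_def using rsubD(1)[OF M(1)] by force
  then show ?case using len_refl[OF M(1)] by simp
next
  case (Suc k)
  have uQ: "u \<in> carrier Q" and uk: "u [^] k \<in> Units Q" using u Units_pow_closed by auto
  have MQ: "M \<subseteq> carrier Q" using rsubD(1)[OF M(1)] by blast
  have eq: "(u [^] Suc k) \<^bold>* M = (u [^] k) \<^bold>* u \<^bold>* M" for k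
    unfolding scale_def using uQ MQ by (force simp: m_assoc)
  have sub: "(u [^] k) \<^bold>* M \<subseteq> M"
  proof (induction k)
    case (Suc k)
    then show ?case unfolding eq using scale_mono[OF M(2)] by blast
  qed (use MQ in \<open>auto elim!: scale_memE\<close>)
  have "len ((u [^] Suc k) \<^bold>* M) M =
      len ((u [^] k) \<^bold>* u \<^bold>* M) ((u [^] k) \<^bold>* M) + len ((u [^] k) \<^bold>* M) M"
    unfolding eq using M sub uQ uk by (intro len_add rsub_scale scale_mono) auto
  also have "len ((u [^] k) \<^bold>* u \<^bold>* M) ((u [^] k) \<^bold>* M) = len (u \<^bold>* M) M"
    using uk M(2) MQ by (intro len_scale) auto
  finally show ?case using Suc by (simp add: distrib_right)
qed

end

context local_fraction_overring
begin

text \<open>Modulo \<open>m\<close> the polynomial stays monic, so it has finitely many roots in the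
  infinite residue field.\<close>

lemma monic_nonroot:
  assumes inf: "infinite (carrier (R Quot m))" and p: "set p \<subseteq> carrier R"
  shows "\<exists>b\<in>carrier R. eval (\<one> # p) b \<notin> m"
proof (rule ccontr)
  assume *: "\<not> ?thesis"
  interpret R: cring R by (rule cring_R)
  interpret m: ideal m R by (rule m_ideal)
  have max: "maximalideal m R" using local unfolding local_ring_def by blast
  interpret F: field "R Quot m" by (rule maximalideal.quotient_is_field[OF max cring_R])
  let ?h = "\<lambda>r. m +>\<^bsub>R\<^esub> r"
  interpret h: ring_hom_ring R "R Quot m" ?h by (rule m.rcos_ring_hom_ring)
  have ev: "R.eval = eval"
    using eval_consistent[of "carrier R"] R_eq subcring unfolding subcring_def by metis
  let ?f = "map ?h (\<one> # p)"
  have "?h \<one> = \<one>\<^bsub>R Quot m\<^esub>" using h.hom_one by simp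
  then have "polynomial\<^bsub>R Quot m\<^esub> (carrier (R Quot m)) ?f"
    using p h.hom_closed F.one_not_zero unfolding polynomial_def by auto
  then have "finite {y. F.is_root ?f y}"
    using F.finite_number_of_roots unfolding univ_poly_carrier by blast
  moreover have "carrier (R Quot m) \<subseteq> {y. F.is_root ?f y}"
  proof
    fix y assume y: "y \<in> carrier (R Quot m)"
    then obtain b where b: "b \<in> carrier R" "y = ?h b" unfolding FactRing_def A_RCOSETS_def' by auto
    have "F.eval ?f (?h b) = ?h (R.eval (\<one> # p) b)"
      using h.eval_hom'[of b "\<one> # p"] b(1) p by simp
    also have "\<dots> = ?h (eval (\<one> # p) b)" unfolding ev ..
    also have "\<dots> = \<zero>\<^bsub>R Quot m\<^esub>"
      using * b(1) R.a_rcos_zero[OF m_ideal] unfolding FactRing_def by auto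
    finally show "y \<in> {y. F.is_root ?f y}" using b y unfolding F.is_root_def by simp
  qed
  ultimately show False using inf finite_subset by blast
qed

text \<open>The length of \<open>M / xR\<close>, computed through \<open>xM\<close> and through
  \<open>R\<close>, contains the length of \<open>M / R\<close> once each way, because
  \<open>xM / xR\<close> is isomorphic to \<open>M / R\<close>. This length cancels: it is at most
  that of \<open>R / x^k R\<close>, hence finite.\<close>

lemma len_scale_overmodule:
  assumes fin: "len (x \<^bold>* carrier R) (carrier R) \<noteq> \<infinity>"
    and M: "rsub M" "carrier R \<subseteq> M" "\<And>w. w \<in> M \<Longrightarrow> x [^] (k::nat) \<otimes> w \<in> carrier R"
  shows "len (x \<^bold>* M) M = len (x \<^bold>* carrier R) (carrier R)"
proof -
  let ?u = "x [^] k"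
  have u: "?u \<in> Units Q" using x Units_pow_closed by blast
  have "x \<^bold>* carrier R \<subseteq> carrier R" using R_mult[OF xR] by (auto elim!: scale_memE)
  note len_pow = len_scale_pow[OF x(2) rsub_R this]
  have MQ: "M \<subseteq> carrier Q" using rsubD(1)[OF M(1)] by blast
  have "len (carrier R) M = len (?u \<^bold>* carrier R) (?u \<^bold>* M)"
    using len_scale[OF u] R_sub MQ by (simp add: subset_iff)
  also have "\<dots> \<le> len (?u \<^bold>* carrier R) (carrier R)"
    using M(3) by (intro len_mono) (auto elim!: scale_memE)
  finally have "len (carrier R) M \<le> of_nat k * len (x \<^bold>* carrier R) (carrier R)"
    unfolding len_pow .
  then have RM: "len (carrier R) M \<noteq> \<infinity>"
    by (rule not_infinity_if_le) (use fin in \<open>auto simp: of_nat_eq_enat\<close>)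
  have xM: "x \<^bold>* M \<subseteq> M" using rsubD(4)[OF M(1) xR] by (auto elim!: scale_memE)
  have xR': "x \<^bold>* carrier R \<subseteq> carrier R" using R_mult[OF xR] by (auto elim!: scale_memE)
  have "len (x \<^bold>* carrier R) M = len (x \<^bold>* carrier R) (x \<^bold>* M) + len (x \<^bold>* M) M"
    using M xM xQ by (intro len_add rsub_scale rsub_R scale_mono) auto
  moreover have "len (x \<^bold>* carrier R) M = len (x \<^bold>* carrier R) (carrier R) + len (carrier R) M"
    using M xR' xQ by (intro len_add rsub_scale rsub_R) auto
  moreover have "len (x \<^bold>* carrier R) (x \<^bold>* M) = len (carrier R) M"
    using len_scale[OF x(2)] R_sub MQ by (simp add: subset_iff)
  ultimately show ?thesis using RM by (auto simp: add.commute enat_add_left_cancel)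
qed

text \<open>An element of the conductor outside \<open>m\<close> would be a unit of \<open>R\<close>
  and put 1 into the conductor. So the conductor lies in \<open>m \<subseteq> x Rbar\<close>, and
  \<open>Rbar / x Rbar\<close> has finite length. Adding the length of \<open>Rbar / R\<close>
  bounds \<open>Rbar / xR\<close>, which contains \<open>R / xR\<close>.\<close>

lemma finite_len_x:
  assumes fin: "len c (carrier R) \<noteq> \<infinity>" and one: "\<one> \<notin> c"
  shows "len (x \<^bold>* carrier R) (carrier R) \<noteq> \<infinity>"
proof -
  have VQ: "Rbar \<subseteq> carrier Q" using rsubD(1)[OF rsub_Rbar] by blast
  have cm: "c \<subseteq> m"
  proof
    fix q assume q: "q \<in> c"
    show "q \<in> m"
    proof (rule ccontr)
      assume "q \<notin> m"
      then obtain s where "s \<in> carrier R" "q \<otimes> s = \<one>" using unit_if_not_mem_m c_subset q by blast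
      then show False using c_mult[OF q, of s] R_subset_Rbar one by auto
    qed
  qed
  have mV: "m \<subseteq> x \<^bold>* Rbar"
  proof
    fix b assume b: "b \<in> m"
    then have "b \<in> carrier Q" using rsubD(1)[OF rsub_m] by blast
    then have "b = x \<otimes> (inv x \<otimes> b)" using x xQ by (simp add: m_assoc[symmetric])
    then show "b \<in> x \<^bold>* Rbar" using scale_mem[OF m_div_x_integral[OF b], of x] by simp
  qed
  have xV: "x \<^bold>* Rbar \<subseteq> Rbar" using rsubD(4)[OF rsub_Rbar xR] by (auto elim!: scale_memE)
  note f = finite_len_Rbar[OF fin]
  have "len c Rbar = len c (carrier R) + len (carrier R) Rbar"
    using rsub_c rsub_R rsub_Rbar c_subset R_subset_Rbar by (intro len_add) auto
  then have "len c Rbar \<noteq> \<infinity>" using fin f by auto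
  moreover have "len (x \<^bold>* Rbar) Rbar \<le> len c Rbar" using cm mV by (intro len_mono) auto
  ultimately have 1: "len (x \<^bold>* Rbar) Rbar \<noteq> \<infinity>" using not_infinity_if_le by blast
  have "len (x \<^bold>* carrier R) (x \<^bold>* Rbar) = len (carrier R) Rbar"
    using len_scale[OF x(2)] R_sub VQ by (simp add: subset_iff)
  moreover have "len (x \<^bold>* carrier R) Rbar = len (x \<^bold>* carrier R) (x \<^bold>* Rbar) + len (x \<^bold>* Rbar) Rbar"
    using xV R_subset_Rbar xQ by (intro len_add rsub_scale rsub_R rsub_Rbar scale_mono) auto
  ultimately have "len (x \<^bold>* carrier R) Rbar \<noteq> \<infinity>" using f 1 by auto
  moreover have "len (x \<^bold>* carrier R) (carrier R) \<le> len (x \<^bold>* carrier R) Rbar"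
    using R_subset_Rbar by (intro len_mono) auto
  ultimately show ?thesis using not_infinity_if_le by blast
qed

text \<open>A module \<open>M\<close> with \<open>R \<subseteq> M \<subseteq> x\<^sup>-\<^sup>k R\<close> has \<open>\<ell>(M / xM) = \<ell>(R / xR)\<close>, so the powers of \<open>u\<close>
  cannot remain independent modulo \<open>x\<close>.\<close>

lemma unimodular_relation:
  assumes fin: "len (x \<^bold>* carrier R) (carrier R) \<noteq> \<infinity>"
    and u: "u \<in> carrier Q" "x [^] (N::nat) \<otimes> u \<in> carrier R"
  obtains p q where "set p \<subseteq> carrier R" "set q \<subseteq> carrier R"
    "eval (\<one> # p) u \<oplus> x \<otimes> eval q u = \<zero>"
proof -
  obtain e where e: "len (x \<^bold>* carrier R) (carrier R) = enat e" using fin by auto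
  \<comment> \<open>One power more than the length \<open>e\<close> of \<open>M / xM\<close>: the
    \<open>e + 1\<close> inclusions from \<open>L 0 = xM\<close> up to \<open>L (e + 1)\<close>
    cannot all be strict.\<close>
  let ?M = "powspan u (Suc e)"
  have M: "rsub ?M" "carrier R \<subseteq> ?M" using rsub_powspan R_subset_powspan u(1) by blast+
  have pw: "x [^] (N * Suc e) \<otimes> w \<in> carrier R" if "w \<in> ?M" for w
    using scale_powspan[OF u(2) R_pow[OF xR] u(1) refl that] nat_pow_pow[OF xQ, of N "Suc e"] by (simp)
  have lenM: "len (x \<^bold>* ?M) ?M = enat e" using len_scale_overmodule[OF fin M pw] e by simp
  have xM: "x \<^bold>* ?M \<subseteq> ?M" using rsubD(4)[OF M(1) xR] by (auto elim!: scale_memE)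
  define L where "L k = powspan u k \<^bold>+ x \<^bold>* ?M" for k
  have L: "rsub (L k)" "x \<^bold>* ?M \<subseteq> L k" "powspan u k \<subseteq> L k" for k
    unfolding L_def using rsub_ssum ssum_ge1 ssum_ge2 rsub_powspan rsub_scale[OF M(1) xQ] u(1) by auto
  have NM: "L k \<subseteq> ?M" if "k \<le> Suc e" for k
    unfolding L_def using powspan_mono[OF u(1) that] xM M(1) by (intro ssum_least) auto
  have Nmono: "L k \<subseteq> L (Suc k)" for k
    unfolding L_def using powspan_Suc_ge[OF u(1), of k] by (intro ssum_mono) auto
  have "\<exists>k<Suc e. L (Suc k) = L k"
  proof (rule ccontr)
    assume "\<not> ?thesis"
    then have "L k \<subset> L (Suc k)" if "k < Suc e" for k using that Nmono[of k] by blast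
    then have "enat (Suc e) \<le> len (x \<^bold>* ?M) ?M"
      unfolding len_def using L NM by (intro height_ge[where N = L]) auto
    then show False using lenM by simp
  qed
  then obtain k where "L (Suc k) = L k" by blast
  moreover have "u [^] k \<in> L (Suc k)" using pow_mem_powspan[OF u(1)] L(3) by blast
  ultimately obtain v w where vw: "v \<in> powspan u k" "w \<in> ?M" "u [^] k = v \<oplus> x \<otimes> w"
    unfolding L_def by (auto elim!: ssum_memE scale_memE)
  obtain p where p: "set p \<subseteq> carrier R" "length p = k" "eval p u = \<ominus> v"
    by (rule powspan_evalE[OF u(1) rsub_neg[OF rsub_powspan[OF u(1)] vw(1)]])
  obtain q where q: "set q \<subseteq> carrier R" "eval q u = \<ominus> w"
    by (rule powspan_evalE[OF u(1) rsub_neg[OF rsub_powspan[OF u(1)] vw(2)]])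
  have vQ: "v \<in> carrier Q" "w \<in> carrier Q" using vw rsubD(1)[OF rsub_powspan[OF u(1)]] by auto
  have "eval (\<one> # p) u \<oplus> x \<otimes> eval q u = (v \<oplus> x \<otimes> w) \<oplus> \<ominus> v \<oplus> x \<otimes> \<ominus> w"
    using p q vw(3) vQ xQ by simp
  also have "\<dots> = \<zero>" using vQ xQ by algebra
  finally show ?thesis using that p q by blast
qed

text \<open>Let \<open>f\<close> be the sum of \<open>\<one> # p\<close> and \<open>x q\<close>, so
  \<open>f(u) = 0\<close>. If \<open>b\<close> is not a root of the monic part modulo
  \<open>m\<close>, then \<open>f(b)\<close> is a unit because \<open>x q(b) \<in> m\<close>.
  Expanding \<open>f\<close> at \<open>b\<close> gives the relation that makes
  \<open>1 / (u - b)\<close> integral.\<close>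

lemma integral_linear_fraction:
  assumes inf: "infinite (carrier (R Quot m))" and fin: "len (x \<^bold>* carrier R) (carrier R) \<noteq> \<infinity>"
    and u: "u \<in> carrier Q" "x [^] (N::nat) \<otimes> u \<in> carrier R"
  obtains b where "b \<in> carrier R" "u \<ominus> b \<in> Units Q" "inv (u \<ominus> b) \<in> Rbar"
proof -
  obtain p q where pq: "set p \<subseteq> carrier R" "set q \<subseteq> carrier R" "eval (\<one> # p) u \<oplus> x \<otimes> eval q u = \<zero>"
    using unimodular_relation[OF fin u] by blast
  obtain b where b: "b \<in> carrier R" "eval (\<one> # p) b \<notin> m" using monic_nonroot[OF inf pq(1)] by blast
  let ?v = "u \<ominus> b" and ?p = "\<one> # p"
  have p1: "set ?p \<subseteq> carrier R" using pq by auto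
  have bQ: "b \<in> carrier Q" using b R_sub by auto
  have v: "?v \<in> carrier Q" using u bQ by auto
  note P = rsubD[OF rsub_powspan[OF v]]
  obtain w where w: "w \<in> powspan ?v (length ?p)" "eval ?p u = eval ?p b \<oplus> ?v \<otimes> w"
    using eval_shift[OF u(1) b(1) p1] by blast
  obtain w' where w': "w' \<in> powspan ?v (length q)" "eval q u = eval q b \<oplus> ?v \<otimes> w'"
    using eval_shift[OF u(1) b(1) pq(2)] by blast
  have R1: "subring (carrier R) Q" using subcring unfolding subcring_def by blast
  have evR: "eval f b \<in> carrier R" if "set f \<subseteq> carrier R" for f
    using eval_mem_R[OF that b(1)] .
  let ?s = "eval ?p b \<oplus> x \<otimes> eval q b" and ?w = "w \<oplus> x \<otimes> w'" and ?n = "max (length ?p) (length q)"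
  have evQ: "eval ?p b \<in> carrier Q" "eval q b \<in> carrier Q" using evR pq p1 R_sub by blast+
  have xq: "x \<otimes> eval q b \<in> m"
    using rsubD(4)[OF rsub_m evR[OF pq(2)] x(1)] xQ evQ by (simp add: m_comm)
  have "?s \<notin> m"
  proof
    assume "?s \<in> m"
    then have "?s \<ominus> x \<otimes> eval q b \<in> m" using rsub_diff[OF rsub_m] xq by blast
    moreover have "?s \<ominus> x \<otimes> eval q b = eval ?p b" using xQ evQ by algebra
    ultimately show False using b(2) by simp
  qed
  moreover have sR: "?s \<in> carrier R" using evR[OF p1] evR[OF pq(2)] xR by (intro R_add R_mult)
  ultimately obtain s' where s': "s' \<in> carrier R" "?s \<otimes> s' = \<one>" using unit_if_not_mem_m by blast
  have "w \<in> powspan ?v ?n" "w' \<in> powspan ?v ?n"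
    using w(1) w'(1) powspan_mono[OF v, of "length ?p" ?n] powspan_mono[OF v, of "length q" ?n]
    by auto
  then have wn: "?w \<in> powspan ?v ?n" using xR by (intro P(3,4)) auto
  have wQ: "w \<in> carrier Q" "w' \<in> carrier Q" using w(1) w'(1) P(1) by auto
  have "?s \<oplus> ?v \<otimes> ?w = (eval ?p b \<oplus> ?v \<otimes> w) \<oplus> x \<otimes> (eval q b \<oplus> ?v \<otimes> w')"
    using wQ evQ v xQ by (simp add: r_distr a_ac m_ac)
  then have "?s \<oplus> ?v \<otimes> ?w = \<zero>" using pq(3) w(2) w'(2) by simp
  then show ?thesis using inverse_integral[OF v wn sR s'] that b(1) by blast
qed

text \<open>Principal \<open>Rbar\<close>-ideals inside the conductor are ideals of the Noetherian
  ring \<open>R\<close>, so a maximal one exists. When 1 is in the conductor, it serves as the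
  generator.\<close>

lemma conductor_principal:
  assumes inf: "infinite (carrier (R Quot m))" and fin: "len c (carrier R) \<noteq> \<infinity>"
  obtains y where "y \<in> c" "y \<in> Units Q" "c = y \<^bold>* Rbar"
proof (cases "\<one> \<in> c")
  case True
  have "c = \<one> \<^bold>* Rbar"
  proof
    show "c \<subseteq> \<one> \<^bold>* Rbar"
    proof
      fix q assume "q \<in> c"
      then have "q \<in> Rbar" "q \<in> carrier Q" using c_subset R_subset_Rbar R_sub by auto
      then show "q \<in> \<one> \<^bold>* Rbar" using scale_mem[of q Rbar \<one>] by simp
    qed
  qed (use c_mult[OF True] in \<open>auto elim!: scale_memE\<close>)
  then show ?thesis using that True by blast
next
  case False
  note f = finite_len_x[OF fin False]
  obtain N where N: "x [^] (N::nat) \<in> c" using pow_mem_if_finite_colength[OF rsub_c c_subset fin] by blast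
  note V = rsubD[OF rsub_Rbar]
  have V1: "\<one> \<in> Rbar" using R_subset_Rbar by auto
  \<comment> \<open>Requiring \<open>x^N \<in> y Rbar\<close> bounds the denominator of
    \<open>u = w / y\<close>: if \<open>x^N = y v\<close>, then \<open>x^N u = v w\<close> lies in
    the conductor.\<close>
  let ?F = "{y \<^bold>* Rbar | y. y \<in> c \<and> y \<in> Units Q \<and> x [^] N \<in> y \<^bold>* Rbar}"
  have "x [^] N \<in> Units Q" using x Units_pow_closed by blast
  moreover have "x [^] N \<in> (x [^] N) \<^bold>* Rbar" using scale_mem[OF V1, of "x [^] N"] xQ by simp
  ultimately have F1: "?F \<noteq> {}" using N by blast
  have F2: "rsub I \<and> I \<subseteq> carrier R" if "I \<in> ?F" for I
    using that rsub_scale[OF rsub_Rbar] c_mult c_subset Units_closed by (fastforce elim!: scale_memE)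
  obtain M where M: "M \<in> ?F" "\<And>I. I \<in> ?F \<Longrightarrow> M \<subseteq> I \<Longrightarrow> I = M"
    using maximal_submodule[OF F1 F2] by blast
  obtain y where y: "y \<in> c" "y \<in> Units Q" "x [^] N \<in> y \<^bold>* Rbar" "M = y \<^bold>* Rbar" using M(1) by blast
  have yQ: "y \<in> carrier Q" using y Units_closed by blast
  have "w \<in> y \<^bold>* Rbar" if w: "w \<in> c" for w
  proof -
    have wQ: "w \<in> carrier Q" using w rsubD(1)[OF rsub_c] by blast
    let ?u = "inv y \<otimes> w"
    have u: "?u \<in> carrier Q" using y wQ by simp
    have yu: "y \<otimes> ?u = w" using y yQ wQ by (simp add: m_assoc[symmetric])
    obtain v where v: "v \<in> Rbar" "x [^] N = y \<otimes> v" using y(3) by (rule scale_memE)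
    have "x [^] N \<otimes> ?u = v \<otimes> (y \<otimes> ?u)" using v yQ u V(1) by (simp add: m_ac del: Units_r_inv Units_l_inv)
    then have "x [^] N \<otimes> ?u \<in> carrier R"
      using yu c_mult[OF w v(1)] c_subset wQ V(1)[OF v(1)] by (auto simp: m_comm)
    then obtain b where b: "b \<in> carrier R" "?u \<ominus> b \<in> Units Q" "inv (?u \<ominus> b) \<in> Rbar"
      using integral_linear_fraction[OF inf f u] by blast
    let ?v = "?u \<ominus> b" and ?t = "inv (?u \<ominus> b)"
    have bQ: "b \<in> carrier Q" using b R_sub by blast
    have vQ: "?v \<in> carrier Q" "?t \<in> carrier Q" using b(2) by auto
    have vt: "?v \<otimes> ?t = \<one>" using b(2) by simp
    \<comment> \<open>The new generator is \<open>y (u - b) = w - b y\<close>. With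
      \<open>t = 1 / (u - b)\<close> it satisfies \<open>y = ?y t\<close> and
      \<open>w = ?y (1 + b t)\<close>, so \<open>?y Rbar\<close> contains both \<open>y\<close> and
      \<open>w\<close>; maximality of \<open>y Rbar\<close> finishes.\<close>
    let ?y = "y \<otimes> ?v"
    have "?y = y \<otimes> ?u \<ominus> b \<otimes> y" using yQ u bQ by algebra
    then have yc: "?y \<in> c" using yu w y(1) rsubD(4)[OF rsub_c b(1)] rsub_diff[OF rsub_c] by simp
    have "y = ?y \<otimes> ?t" using yQ vQ vt by (simp add: m_assoc)
    then have "y \<otimes> z \<in> ?y \<^bold>* Rbar" if "z \<in> Rbar" for z
      using scale_mem[OF integral_closure_closed(2)[OF b(3) that], of ?y] yQ vQ V(1)[OF that]
      by (metis m_assoc m_closed)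
    then have sub: "y \<^bold>* Rbar \<subseteq> ?y \<^bold>* Rbar" by (auto elim!: scale_memE)
    have "?y \<^bold>* Rbar \<in> ?F" using yc y(2,3) b(2) sub by blast
    then have eq: "?y \<^bold>* Rbar = y \<^bold>* Rbar" using M(2) sub y(4) by blast
    have "w = y \<otimes> (?v \<oplus> b)" using yu u bQ by (simp add: minus_eq a_assoc l_neg)
    also have "\<dots> = ?y \<otimes> \<one> \<oplus> b \<otimes> (?y \<otimes> ?t)"
      using yQ vQ(1) bQ \<open>y = ?y \<otimes> ?t\<close>[symmetric] by (simp add: r_distr m_comm)
    also have "\<dots> = ?y \<otimes> (\<one> \<oplus> b \<otimes> ?t)" using yQ vQ bQ by (simp add: r_distr m_ac)
    finally show ?thesis
      using eq scale_mem[OF V(3)[OF V1 V(4)[OF b(1) b(3)]], of ?y] by simp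
  qed
  moreover have "y \<^bold>* Rbar \<subseteq> c" using c_mult[OF y(1)] by (auto elim!: scale_memE)
  ultimately show ?thesis using that y by blast
qed

end

section \<open>Multiplicity of the conductor\<close>

context local_fraction_overring
begin

text \<open>The exponent starts at 1, since the zeroth power is \<open>R\<close> and not
  \<open>Rbar\<close>. The product of two principal \<open>Rbar\<close>-ideals is generated by the
  product of the generators.\<close>

lemma ideal_power_conductor:
  assumes y: "y \<in> c" "y \<in> Units Q" "c = y \<^bold>* Rbar"
  shows "ideal_power R c (Suc n) = (y [^] Suc n) \<^bold>* Rbar"
proof (induction n)
  case 0
  have "carrier R \<cdot>\<^bsub>R\<^esub> c \<subseteq> c"
  proof
    fix q assume "q \<in> carrier R \<cdot>\<^bsub>R\<^esub> c"
    then show "q \<in> c"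
      by (induction rule: ideal_prod.induct) (simp_all add: rsubD(3,4)[OF rsub_c])
  qed
  moreover have "q \<in> carrier R \<cdot>\<^bsub>R\<^esub> c" if "q \<in> c" for q
    using ideal_prod.prod[OF R_one that, of R] rsubD(1)[OF rsub_c that] by simp
  ultimately show ?case using y(2) by (auto simp: y(3)[symmetric] Units_closed)
next
  case (Suc n)
  let ?u = "y [^] Suc n"
  have yQ: "y \<in> carrier Q" "?u \<in> carrier Q" using y(2) Units_closed by auto
  note V = rsubD[OF rsub_Rbar]
  have eq: "y [^] Suc (Suc n) = ?u \<otimes> y" by simp
  have uy: "?u \<otimes> y \<in> carrier Q" using yQ by simp
  have "(?u \<^bold>* Rbar) \<cdot>\<^bsub>R\<^esub> c = (?u \<otimes> y) \<^bold>* Rbar"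
  proof (intro antisym subsetI)
    fix q assume "q \<in> (?u \<^bold>* Rbar) \<cdot>\<^bsub>R\<^esub> c"
    then show "q \<in> (?u \<otimes> y) \<^bold>* Rbar"
    proof (induction rule: ideal_prod.induct)
      case (prod i j)
      obtain v where v: "v \<in> Rbar" "i = ?u \<otimes> v" using prod(1) by (rule scale_memE)
      have "j \<in> y \<^bold>* Rbar" using prod(2) y(3) by simp
      then obtain w where w: "w \<in> Rbar" "j = y \<otimes> w" by (rule scale_memE)
      have "i \<otimes> j = (?u \<otimes> y) \<otimes> (v \<otimes> w)" using v w yQ V(1) by (simp add: m_ac del: nat_pow_Suc)
      then show ?case using scale_mem[OF integral_closure_closed(2)[OF v(1) w(1)]] by simp
    next
      case (sum s1 s2)
      then show ?case using rsubD(3)[OF rsub_scale[OF rsub_Rbar uy]] by simp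
    qed
  next
    fix q assume "q \<in> (?u \<otimes> y) \<^bold>* Rbar"
    then obtain v where v: "v \<in> Rbar" "q = ?u \<otimes> y \<otimes> v" by (rule scale_memE)
    have "\<one> \<in> Rbar" using R_subset_Rbar by auto
    then have "?u \<otimes> \<one> \<in> ?u \<^bold>* Rbar" by (rule scale_mem)
    moreover have "y \<otimes> v \<in> c" using c_mult[OF y(1) v(1)] .
    ultimately have "(?u \<otimes> \<one>) \<otimes>\<^bsub>R\<^esub> (y \<otimes> v) \<in> (?u \<^bold>* Rbar) \<cdot>\<^bsub>R\<^esub> c" by (rule ideal_prod.prod)
    moreover have "(?u \<otimes> \<one>) \<otimes> (y \<otimes> v) = q" using v yQ V(1) by (simp add: m_assoc del: nat_pow_Suc)
    ultimately show "q \<in> (?u \<^bold>* Rbar) \<cdot>\<^bsub>R\<^esub> c" by simp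
  qed
  then show ?case using Suc unfolding eq by simp
qed

text \<open>Both sides compute the length of \<open>Rbar / y^(n+1) Rbar\<close>, once through
  \<open>R\<close> and once through the powers of \<open>y\<close>.\<close>

lemma len_ideal_power_conductor:
  assumes y: "y \<in> c" "y \<in> Units Q" "c = y \<^bold>* Rbar"
  shows "len (ideal_power R c (Suc n)) (carrier R) + len (carrier R) Rbar = of_nat (Suc n) * len c Rbar"
proof -
  interpret R: cring R by (rule cring_R)
  let ?P = "ideal_power R c (Suc n)"
  have "ideal ?P R" using R.ideal_ideal_power ideal_iff_rsub rsub_c c_subset by blast
  then have P: "rsub ?P" "?P \<subseteq> carrier R" using ideal_iff_rsub by auto
  have "len ?P (carrier R) + len (carrier R) Rbar = len ?P Rbar"
    using P rsub_R rsub_Rbar R_subset_Rbar by (intro len_add[symmetric])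
  also have "\<dots> = of_nat (Suc n) * len (y \<^bold>* Rbar) Rbar"
    unfolding ideal_power_conductor[OF y]
    using y c_subset R_subset_Rbar by (intro len_scale_pow rsub_Rbar) auto
  finally show ?thesis using y(3) by simp
qed

text \<open>For \<open>n \<ge> 1\<close> the length of \<open>R / c^n\<close> is
  \<open>n F - g\<close>, where \<open>F\<close> and \<open>g\<close> are the lengths of
  \<open>Rbar / c\<close> and \<open>Rbar / R\<close>. In dimension one it is divided by
  \<open>n\<close>, and \<open>F - g / n\<close> tends to \<open>F\<close>.\<close>

lemma multiplicity_conductor:
  assumes dim: "krull_dim R = 1"
    and inf: "infinite (carrier (R Quot m))" and fin: "len c (carrier R) \<noteq> \<infinity>"
  shows "hilbert_samuel_multiplicity R c = ereal_of_enat (len c Rbar)"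
proof -
  interpret R: cring R by (rule cring_R)
  obtain y where y: "y \<in> c" "y \<in> Units Q" "c = y \<^bold>* Rbar"
    using conductor_principal[OF inf fin] by blast
  obtain g where g: "len (carrier R) Rbar = enat g" using finite_len_Rbar[OF fin] by auto
  have "len c Rbar = len c (carrier R) + len (carrier R) Rbar"
    using rsub_c rsub_R rsub_Rbar c_subset R_subset_Rbar by (intro len_add)
  then obtain F where F: "len c Rbar = enat F" using fin g by auto
  let ?l = "\<lambda>n. module_length R (quotient_module R (ideal_power R c n))"
  have l: "ereal (fact 1 / real n ^ 1) * ereal_of_enat (?l n) = ereal (real F - real g / real n)"
    if n: "n \<ge> 1" for n
  proof -
    obtain k where k: "n = Suc k" using n by (cases n) auto
    have "ideal (ideal_power R c n) R"
      using R.ideal_ideal_power ideal_iff_rsub rsub_c c_subset by blast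
    then have "?l n = len (ideal_power R c n) (carrier R)" by (rule module_length_quotient)
    then have *: "?l n + enat g = of_nat n * enat F"
      using len_ideal_power_conductor[OF y, of k] g F k by simp
    then obtain a where a: "?l n = enat a" by (cases "?l n") (auto simp: of_nat_eq_enat)
    then have "a + g = n * F" using * by (simp add: of_nat_eq_enat)
    then have "real a + real g = real n * real F" by (metis of_nat_add of_nat_mult)
    then have "real a / real n = real F - real g / real n" using n by (simp add: field_simps)
    then show ?thesis using a by simp
  qed
  have "(\<lambda>n. ereal (real F - real g / real n)) \<longlonglongrightarrow> ereal (real F - 0)"
    by (intro tendsto_ereal tendsto_diff tendsto_const lim_const_over_n)
  moreover have "\<forall>\<^sub>F n in sequentially. ereal (real F - real g / real n) =
      ereal (fact 1 / real n ^ 1) * ereal_of_enat (?l n)"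
    by (rule eventually_mono[OF eventually_ge_at_top[of 1]]) (rule l[symmetric])
  ultimately have "(\<lambda>n. ereal (fact 1 / real n ^ 1) * ereal_of_enat (?l n)) \<longlonglongrightarrow> ereal (real F - 0)"
    by (rule Lim_transform_eventually)
  then have "lim (\<lambda>n. ereal (fact 1 / real n ^ 1) * ereal_of_enat (?l n)) = ereal (real F - 0)"
    by (rule limI)
  then show ?thesis unfolding hilbert_samuel_multiplicity_def Let_def dim F by (simp add: one_enat_def)
qed

section \<open>The bound\<close>

text \<open>A power of \<open>x\<close> in the conductor is a common denominator, and 1 is a regular
  element of \<open>N\<close>.\<close>

lemma fractional_ideal_between:
  assumes fin: "len c (carrier R) \<noteq> \<infinity>" and N: "rsub N" "carrier R \<subseteq> N" "N \<subseteq> Rbar"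
  shows "fractional_ideal R Q N"
proof -
  obtain n where n: "x [^] (n::nat) \<in> c" using pow_mem_if_finite_colength[OF rsub_c c_subset fin] by blast
  have "x [^] n \<in> nonzero_divisors R"
    using nonzero_divisors_iff R_pow[OF xR] Units_pow_closed[OF x(2)] by blast
  moreover have "x [^] n \<otimes> z \<in> carrier R" if "z \<in> N" for z
    using c_mult[OF n, of z] c_subset that N(3) by blast
  moreover have "\<one> \<in> N \<inter> nonzero_divisors Q"
    using N(2) R_one unfolding nonzero_divisors_def by auto
  ultimately show ?thesis unfolding fractional_ideal_def submodule_iff_rsub
    by (intro conjI bexI[of _ "x [^] n"]) (use N(1) in auto)
qed

text \<open>Between \<open>R\<close> and \<open>Rbar\<close> every module is a fractional ideal and
  equals its double dual. Hence \<open>N \<mapsto> \<omega> : N\<close> is injective and reverses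
  strict inclusions.\<close>

lemma len_dual:
  assumes fin: "len c (carrier R) \<noteq> \<infinity>" and can: "canonical_ideal R Q \<omega>"
    and AB: "carrier R \<subseteq> A" "B \<subseteq> Rbar"
  shows "len A B \<le> len (colon Q \<omega> B) (colon Q \<omega> A)"
  unfolding len_def
proof (rule height_antimono_map[where f = "colon Q \<omega>"])
  have w: "rsub \<omega>" using can unfolding canonical_ideal_def fractional_ideal_def submodule_iff_rsub by blast
  have anti: "colon Q \<omega> N' \<subseteq> colon Q \<omega> N" if "N \<subseteq> N'" for N N'
    using that unfolding colon_def by blast
  show "colon Q \<omega> N \<in> {N. rsub N \<and> colon Q \<omega> B \<subseteq> N \<and> N \<subseteq> colon Q \<omega> A}"
    if "N \<in> {N. rsub N \<and> A \<subseteq> N \<and> N \<subseteq> B}" for N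
    using that rsub_colon[OF w, of N] rsubD(1)[of N] anti by auto
  fix N N' assume N: "N \<in> {N. rsub N \<and> A \<subseteq> N \<and> N \<subseteq> B}" "N' \<in> {N. rsub N \<and> A \<subseteq> N \<and> N \<subseteq> B}" "N \<subset> N'"
  then have "fractional_ideal R Q N" "fractional_ideal R Q N'"
    using fractional_ideal_between[OF fin] AB by auto
  then have "colon Q \<omega> (colon Q \<omega> N) = N" "colon Q \<omega> (colon Q \<omega> N') = N'"
    using can unfolding canonical_ideal_def by auto
  then have "colon Q \<omega> N' \<noteq> colon Q \<omega> N" using N(3) by (metis psubset_eq)
  then show "colon Q \<omega> N' \<subset> colon Q \<omega> N" using N(3) anti[of N N'] by blast
qed

text \<open>Here \<open>G\<close> is the generating set of \<open>m\<close>, and \<open>g\<close> is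
  the generator with \<open>g \<omega> \<subseteq> m\<close>. In the proof \<open>W\<close> is the
  product \<open>I\<omega>\<close>.\<close>

lemma len_conductor_bound:
  assumes fin: "len c (carrier R) \<noteq> \<infinity>" and can: "canonical_ideal R Q \<omega>"
    and w: "carrier R \<subseteq> \<omega>" "\<omega> \<subseteq> Rbar" "x \<^bold>* \<omega> \<subseteq> m"
    and G: "finite G" "G \<subseteq> carrier R" "Idl\<^bsub>R\<^esub> G = m"
    and gx: "x \<in> G" "g \<in> G" "g \<noteq> x" "g \<in> colon Q m \<omega>"
  shows "len c Rbar \<le> of_nat (card G) * len c (carrier R)"
proof -
  interpret R: cring R by (rule cring_R)
  have rw: "rsub \<omega>" using can unfolding canonical_ideal_def fractional_ideal_def submodule_iff_rsub by blast
  note W = rsubD[OF rw] and V = rsubD[OF rsub_Rbar]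
  have VQ: "Rbar \<subseteq> carrier Q" using V(1) by blast
  have Gm: "G \<subseteq> m" using R.genideal_self[OF G(2)] G(3) by simp
  have colon_R: "colon Q \<omega> (carrier R) = \<omega>"
  proof
    show "colon Q \<omega> (carrier R) \<subseteq> \<omega>"
    proof
      fix q assume "q \<in> colon Q \<omega> (carrier R)"
      then have "q \<otimes> \<one> \<in> \<omega>" "q \<in> carrier Q" unfolding colon_def using R_one by blast+
      then show "q \<in> \<omega>" by simp
    qed
    show "\<omega> \<subseteq> colon Q \<omega> (carrier R)"
    proof
      fix q assume q: "q \<in> \<omega>"
      then have "q \<otimes> r \<in> \<omega>" if "r \<in> carrier R" for r
        using W(4)[OF that q] W(1)[OF q] R_sub[OF that] by (simp add: m_comm)
      then show "q \<in> colon Q \<omega> (carrier R)" unfolding colon_def using W(1)[OF q] by blast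
    qed
  qed
  have "fractional_ideal R Q (carrier R)"
    using fractional_ideal_between[OF fin rsub_R order_refl R_subset_Rbar] .
  \<comment> \<open>This is reflexivity of \<open>R\<close>, since
    \<open>\<omega> : R = \<omega>\<close>.\<close>
  then have colon_w: "colon Q \<omega> \<omega> = carrier R" using can colon_R unfolding canonical_ideal_def by metis
  have colon_V: "colon Q \<omega> Rbar = c"
  proof
    show "c \<subseteq> colon Q \<omega> Rbar" using w(1) unfolding conductor_def colon_def by blast
    \<comment> \<open>If \<open>q Rbar \<subseteq> \<omega>\<close>, then
      \<open>q v \<omega> \<subseteq> q Rbar \<subseteq> \<omega>\<close> for
      \<open>v \<in> Rbar\<close>, so \<open>q v \<in> \<omega> : \<omega> = R\<close>.\<close>
    show "colon Q \<omega> Rbar \<subseteq> c"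
    proof
      fix q assume q: "q \<in> colon Q \<omega> Rbar"
      then have qQ: "q \<in> carrier Q" and qV: "\<And>v. v \<in> Rbar \<Longrightarrow> q \<otimes> v \<in> \<omega>" unfolding colon_def by auto
      have "q \<otimes> v \<in> carrier R" if v: "v \<in> Rbar" for v
      proof -
        have "q \<otimes> v \<otimes> p \<in> \<omega>" if p: "p \<in> \<omega>" for p
        proof -
          have "p \<in> Rbar" using p w(2) by blast
          then show ?thesis using qV[OF integral_closure_closed(2)[OF v]] qQ V(1) v by (simp add: m_assoc)
        qed
        then have "q \<otimes> v \<in> colon Q \<omega> \<omega>" unfolding colon_def using qQ V(1)[OF v] by simp
        then show ?thesis using colon_w by simp
      qed
      then show "q \<in> c" unfolding conductor_def colon_def using qQ by blast
    qed
  qed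
  define z where "z = inv x \<otimes> g"
  have gQ: "g \<in> carrier Q" using gx G(2) R_sub by blast
  have zV: "z \<in> Rbar" unfolding z_def using m_div_x_integral Gm gx by blast
  have zQ: "z \<in> carrier Q" using zV V(1) by blast
  have xz: "x \<otimes> z = g" unfolding z_def using gQ x xQ by (simp add: m_assoc[symmetric])
  define I where "I = carrier R \<^bold>+ z \<^bold>* carrier R"
  define W where "W = \<omega> \<^bold>+ z \<^bold>* \<omega>"
  have I: "rsub I" "carrier R \<subseteq> I" "z \<^bold>* carrier R \<subseteq> I"
    unfolding I_def using rsub_R rsub_scale[OF rsub_R zQ] rsub_ssum ssum_ge1 ssum_ge2 by auto
  have IV: "I \<subseteq> Rbar"
    unfolding I_def using R_subset_Rbar zV integral_closure_closed(2)
    by (intro ssum_least rsub_Rbar) (auto elim!: scale_memE)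
  have W': "rsub W" "\<omega> \<subseteq> W"
    unfolding W_def using rw rsub_scale[OF rw zQ] rsub_ssum ssum_ge1 by auto
  have IW: "I \<subseteq> W" unfolding I_def W_def using w(1) by (intro ssum_mono scale_mono)
  \<comment> \<open>The dual of \<open>I\<close> is the kernel of multiplication by \<open>z\<close>
    from \<open>\<omega>\<close> to \<open>Q / \<omega>\<close>; this links duality with the length
    of \<open>W / \<omega>\<close>.\<close>
  have "{b \<in> \<omega>. z \<otimes> b \<in> \<omega>} \<subseteq> colon Q \<omega> I"
  proof (clarsimp simp: colon_def W(1))
    fix b i assume b: "b \<in> \<omega>" "z \<otimes> b \<in> \<omega>" and i: "i \<in> I"
    obtain r s where rs: "r \<in> carrier R" "s \<in> carrier R" "i = r \<oplus> z \<otimes> s"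
      using i unfolding I_def by (auto elim!: ssum_memE scale_memE)
    have "b \<otimes> i = r \<otimes> b \<oplus> s \<otimes> (z \<otimes> b)"
      using rs R_sub W(1)[OF b(1)] zQ by (simp add: r_distr m_ac)
    then show "b \<otimes> i \<in> \<omega>" using W(3,4) b rs by simp
  qed
  moreover have "colon Q \<omega> I \<subseteq> {b \<in> \<omega>. z \<otimes> b \<in> \<omega>}"
  proof
    fix b assume "b \<in> colon Q \<omega> I"
    then have b: "b \<in> carrier Q" "\<And>i. i \<in> I \<Longrightarrow> b \<otimes> i \<in> \<omega>" unfolding colon_def by auto
    have "z \<otimes> \<one> \<in> I" "\<one> \<in> I" using I(2,3) scale_mem[OF R_one, of z] R_one by blast+
    then have "b \<otimes> (z \<otimes> \<one>) \<in> \<omega>" "b \<otimes> \<one> \<in> \<omega>" using b(2) by blast+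
    then show "b \<in> {b \<in> \<omega>. z \<otimes> b \<in> \<omega>}" using b(1) zQ by (simp add: m_comm)
  qed
  ultimately have colon_I: "colon Q \<omega> I = {b \<in> \<omega>. z \<otimes> b \<in> \<omega>}" by (rule antisym[rotated])
  have "len (carrier R) I \<le> len (colon Q \<omega> I) \<omega>"
    using len_dual[OF fin can order_refl IV] colon_R by simp
  also have "\<dots> \<le> len \<omega> W" unfolding colon_I W_def by (rule len_sum_ge[OF rw rw zQ])
  finally have RI: "len (carrier R) I \<le> len \<omega> W" .
  have "len (carrier R) I \<le> len (carrier R) Rbar" using IV by (intro len_mono) auto
  then have RI_fin: "len (carrier R) I \<noteq> \<infinity>" using finite_len_Rbar[OF fin] not_infinity_if_le by blast
  \<comment> \<open>The length of \<open>W / R\<close> is computed through \<open>I\<close> and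
    through \<open>\<omega>\<close>. As \<open>I / R\<close> is finite and no longer than
    \<open>W / \<omega>\<close>, the exchange bounds \<open>\<omega> / R\<close> by
    \<open>W / I\<close>.\<close>
  have "len (carrier R) I + len I W = len (carrier R) W"
    using I W' IW rsub_R by (intro len_add[symmetric])
  also have "\<dots> = len (carrier R) \<omega> + len \<omega> W"
    using rw W' rsub_R w(1) by (intro len_add)
  finally have Rw: "len (carrier R) \<omega> \<le> len I W" using enat_exchange RI RI_fin by blast
  let ?H = "G - {x, g}"
  have xIQ: "rsub (x \<^bold>* I)" using rsub_scale[OF I(1) xQ] .
  \<comment> \<open>Since \<open>h / x\<close> is integral, \<open>a (h / x)\<close> lies in the
    conductor and hence in \<open>R \<subseteq> I\<close>.\<close>
  have "a \<otimes> h \<in> x \<^bold>* I" if "h \<in> ?H" "a \<in> c" for h a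
  proof -
    have h: "h \<in> m" "h \<in> carrier Q" using that Gm rsubD(1)[OF rsub_m] by auto
    have a: "a \<in> carrier Q" using that rsubD(1)[OF rsub_c] by blast
    have "a \<otimes> (inv x \<otimes> h) \<in> I" using c_mult[OF that(2) m_div_x_integral[OF h(1)]] c_subset I(2) by blast
    then have "x \<otimes> (a \<otimes> (inv x \<otimes> h)) \<in> x \<^bold>* I" by (rule scale_mem)
    moreover have "x \<otimes> (a \<otimes> (inv x \<otimes> h)) = a \<otimes> ((x \<otimes> inv x) \<otimes> h)"
      using a h x xQ by (simp add: m_ac del: Units_r_inv Units_l_inv)
    ultimately show ?thesis using h x by simp
  qed
  then have "\<exists>B. rsub B \<and> x \<^bold>* I \<subseteq> B \<and> ?H \<subseteq> B \<and> len (x \<^bold>* I) B \<le> of_nat (card ?H) * len c (carrier R)"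
    using G(1,2) R_sub c_subset by (intro adjoin_generators xIQ) auto
  then obtain B where B: "rsub B" "x \<^bold>* I \<subseteq> B" "?H \<subseteq> B"
    "len (x \<^bold>* I) B \<le> of_nat (card ?H) * len c (carrier R)" by blast
  \<comment> \<open>The two generators not adjoined are already in \<open>xI\<close>, as
    \<open>x = x * 1\<close> and \<open>g = x z\<close>. So \<open>B\<close> contains all of
    \<open>m\<close>.\<close>
  have "x \<otimes> \<one> \<in> B" "x \<otimes> (z \<otimes> \<one>) \<in> B"
    using B(2) I(2,3) scale_mem[OF R_one, of z] R_one by (blast intro: scale_mem)+
  then have "x \<in> B" "g \<in> B" using xQ zQ xz by simp_all
  then have "G \<subseteq> B \<inter> carrier R" using B(3) G(2) by blast
  moreover have "ideal (B \<inter> carrier R) R" unfolding ideal_iff_rsub using rsub_inter[OF B(1) rsub_R] by auto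
  ultimately have mB: "m \<subseteq> B" using R.genideal_minimal[of "B \<inter> carrier R" G] G(3) by blast
  \<comment> \<open>Both containments enter here: \<open>x \<omega> \<subseteq> m\<close> from the
    canonical reduction and \<open>x z \<omega> = g \<omega> \<subseteq> m\<close> from the choice
    of \<open>g\<close>.\<close>
  have xW: "x \<^bold>* W \<subseteq> m"
  proof
    fix q assume "q \<in> x \<^bold>* W"
    then obtain a b where ab: "a \<in> \<omega>" "b \<in> \<omega>" "q = x \<otimes> (a \<oplus> z \<otimes> b)"
      unfolding W_def by (auto elim!: ssum_memE scale_memE)
    have "q = x \<otimes> a \<oplus> g \<otimes> b" unfolding xz[symmetric] using ab W(1) zQ xQ by (simp add: r_distr m_assoc)
    moreover have "x \<otimes> a \<in> m" using w(3) scale_mem[OF ab(1)] by blast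
    moreover have "g \<otimes> b \<in> m" using gx(4) ab(2) unfolding colon_def by blast
    ultimately show "q \<in> m" using rsubD(3)[OF rsub_m] by simp
  qed
  have "len I W = len (x \<^bold>* I) (x \<^bold>* W)"
    using rsubD(1)[OF I(1)] rsubD(1)[OF W'(1)] by (intro len_scale[symmetric] x(2)) auto
  also have "\<dots> \<le> len (x \<^bold>* I) B" using xW mB by (intro len_mono) auto
  also note B(4)
  finally have Rw': "len (carrier R) \<omega> \<le> of_nat (card ?H) * len c (carrier R)" using Rw by (rule order_trans[rotated])
  \<comment> \<open>Duality applied to the whole interval from \<open>R\<close> to
    \<open>Rbar\<close>, whose ends have duals \<open>\<omega>\<close> and the conductor.\<close>
  have "len (carrier R) Rbar \<le> len c \<omega>"
    using len_dual[OF fin can order_refl order_refl] colon_R colon_V by simp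
  also have "\<dots> = len c (carrier R) + len (carrier R) \<omega>"
    using rsub_c rsub_R rw c_subset w(1) by (intro len_add)
  finally have RV: "len (carrier R) Rbar \<le> len c (carrier R) + len (carrier R) \<omega>" .
  have "len c Rbar = len c (carrier R) + len (carrier R) Rbar"
    using rsub_c rsub_R rsub_Rbar c_subset R_subset_Rbar by (intro len_add)
  also have "\<dots> \<le> len c (carrier R) + (len c (carrier R) + of_nat (card ?H) * len c (carrier R))"
    using RV Rw' by (meson add_left_mono order_trans)
  \<comment> \<open>The two copies beyond those of \<open>?H\<close> are \<open>R / c\<close> inside
    \<open>Rbar / c\<close> and \<open>R / c\<close> inside \<open>\<omega> / c\<close>.\<close>
  also have "\<dots> = of_nat (card ?H + 2) * len c (carrier R)" by (simp add: distrib_left mult_2 ac_simps)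
  also have "card ?H + 2 = card G"
    using G(1) gx card_Diff_subset[of "{x, g}" G] card_mono[of G "{x, g}"] by simp
  finally show ?thesis .
qed

end

theorem corollary11:
  fixes R Q :: "('a, 'b) ring_scheme"
    and m Rbar \<cc> \<omega> :: "'a set"
    and x :: 'a
    and xs :: "nat \<Rightarrow> 'a"
    and \<nu> i :: nat
  assumes "noetherian_ring R"
    and "local_ring R m"
    and "krull_dim R = 1"
    and "cohen_macaulay_local R m"
    and "analytically_unramified R m"
    and "infinite (carrier (R Quot m))"
    and "\<nu> = embedding_dim R m"
    and "total_ring_of_fractions R Q"
    and "Rbar = integral_closure R Q"
    and "\<cc> = conductor R Q"
    and "canonical_ideal R Q \<omega>"
    and "carrier R \<subseteq> \<omega>"
    and "\<omega> \<subseteq> Rbar"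
    and "x \<in> m"
    and "minimal_reduction R m (PIdl\<^bsub>R\<^esub> x)"
    and "x <#\<^bsub>Q\<^esub> \<omega> \<subseteq> m"
    and "canonical_reduction R Q m (x <#\<^bsub>Q\<^esub> \<omega>)"
    and "xs 1 = x"
    and "inj_on xs {1..\<nu>}"
    and "minimal_generating_set R m (xs ` {1..\<nu>})"
    and "i \<in> {2..\<nu>}"
    and "xs i \<in> colon Q m \<omega>"
  shows "hilbert_samuel_multiplicity R \<cc>
           \<le> ereal_of_enat (enat \<nu> * module_length R (quotient_module R \<cc>))"
proof -
  have R_eq: "R = Q\<lparr>carrier := carrier R\<rparr>" and Q: "cring Q" "subcring (carrier R) Q"
    using assms(8) unfolding total_ring_of_fractions_def by auto
  have m: "maximalideal m R" using assms(2) unfolding local_ring_def by blast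
  then have "\<one>\<^bsub>R\<^esub> \<noteq> \<zero>\<^bsub>R\<^esub>"
    using maximalideal.I_notcarr[OF m] ideal.one_imp_carrier[of m R] maximalideal.axioms(1)[OF m]
      additive_subgroup.zero_closed[OF ideal.axioms(1)[of m R]] by metis
  moreover have "\<one>\<^bsub>R\<^esub> = \<one>\<^bsub>Q\<^esub>" "\<zero>\<^bsub>R\<^esub> = \<zero>\<^bsub>Q\<^esub>" by (subst R_eq, simp)+
  ultimately interpret fraction_overring Q R
    using Q R_eq assms(1,8)
    by (intro fraction_overring.intro overring.intro overring_axioms.intro fraction_overring_axioms.intro) auto
  interpret R: cring R by (rule cring_R)
  \<comment> \<open>The Cohen-Macaulay property in dimension one supplies a regular element of
    \<open>m\<close>, and this makes \<open>x\<close> a unit of \<open>Q\<close>.\<close>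
  have "depth R m = 1" using assms(3,4) unfolding cohen_macaulay_local_def by simp
  then obtain d where d: "d \<in> m" "d \<in> Units Q"
    using R.nonzero_divisor_if_depth[of m] nonzero_divisors_iff by auto
  have red: "reduction R m (PIdl\<^bsub>R\<^esub> x)" using assms(15) unfolding minimal_reduction_def by blast
  interpret local_fraction_overring Q R m x
    using assms(2,14) red unit_if_reduction[OF maximalideal.axioms(1)[OF m] d assms(14) red]
    by unfold_locales
  have "ideal c R" using ideal_iff_rsub rsub_c c_subset by blast
  then have len: "module_length R (quotient_module R c) = len c (carrier R)"
    by (rule module_length_quotient)
  show ?thesis
  proof (cases "len c (carrier R) = \<infinity>")
    \<comment> \<open>The index \<open>i\<close> forces \<open>\<nu>\<close> to be positive, so the
      right-hand side is infinite.\<close>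
    case True
    then show ?thesis using assms(21) unfolding assms(10) len by (simp add: zero_enat_def[symmetric])
  next
    case False
    let ?G = "xs ` {1..\<nu>}"
    have G: "?G \<subseteq> carrier R" "Idl\<^bsub>R\<^esub> ?G = m" using assms(20) unfolding minimal_generating_set_def by auto
    \<comment> \<open>Injectivity of the enumeration separates \<open>xs i\<close> from
      \<open>xs 1 = x\<close>; it also gives the generating set exactly \<open>\<nu>\<close>
      members.\<close>
    have "xs i \<noteq> x" using assms(18,19,21) inj_onD[OF assms(19), of i 1] by auto
    moreover have "x \<in> ?G" "xs i \<in> ?G" using assms(18,21) by (auto intro: rev_image_eqI[of 1])
    moreover have "x \<^bold>* \<omega> \<subseteq> m" using assms(16) unfolding scale_def l_coset_def by blast
    ultimately have "len c (integral_closure R Q) \<le> of_nat (card ?G) * len c (carrier R)"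
      using G assms(11,12,13,22) False unfolding assms(9) by (intro len_conductor_bound) auto
    also have "card ?G = \<nu>" using card_image[OF assms(19)] by simp
    finally show ?thesis
      using multiplicity_conductor[OF assms(3,6) False] unfolding assms(10) len
      by (simp add: of_nat_eq_enat)
  qed
qed

end
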